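(* Let $\boldsymbol{U}$ be an $n\times n$ unitary (respectively, real orthogonal) matrix, and let $\boldsymbol{G}_k$ be a complex (respectively, real) $n\times n$ matrix of rank $k$. Let $\mathcal{U}$ denote the set of $n\times n$ unitary (respectively, orthogonal) matrices. Then the projection of $\boldsymbol{U}+\boldsymbol{G}_k$ onto the closest unitary (respectively, orthogonal) matrix, $$\boldsymbol{U}+\boldsymbol{G}_k \;\to\; \operatorname*{arg\,min}_{\boldsymbol{V}\in\mathcal{U}} \|\boldsymbol{U}+\boldsymbol{G}_k-\boldsymbol{V}\|_F^2 ,$$ can be performed in $O(k(n^2+nk+k^2))$ steps; that is, there is an algorithm which, given $\boldsymbol{U}$ and $\boldsymbol{G}_k$, outputs such a minimizer using $O(k(n^2+nk+k^2))$ steps, with an absolute implied constant.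
   Context: $\|\cdot\|_F$ is the Frobenius norm and ${}^\dagger$ is the conjugate transpose. The input $\boldsymbol{U}$ is given by its entries, and the rank-$k$ matrix is given in factored form $\boldsymbol{G}_k=\sum_{i=1}^k \boldsymbol{a}_i\boldsymbol{b}_i^\dagger$ with vectors $\boldsymbol{a}_i,\boldsymbol{b}_i$ of length $n$. Steps are scalar arithmetic operations in exact arithmetic, including square roots of scalars, and the eigendecomposition of an $m\times m$ matrix is counted as $O(m^3)$ steps. When $\boldsymbol{A}=\boldsymbol{U}+\boldsymbol{G}_k$ is invertible, the minimizer is unique and equals $\boldsymbol{A}(\boldsymbol{A}^\dagger\boldsymbol{A})^{-1/2}$. *)

theory Defs
  imports Complex_Main "Jordan_Normal_Form.Schur_Decomposition" "Jordan_Normal_Form.DL_Rank"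
begin

section \<open>Matrices\<close>

text \<open>Over the reals the conjugation of the class \<^class>\<open>conjugatable_field\<close> is the identity, so
  \<^const>\<open>mat_adjoint\<close> is transposition and the following set is that of the orthogonal matrices.\<close>

definition unitary_matrices :: "nat \<Rightarrow> 'a :: conjugatable_field mat set" where
  "unitary_matrices n = {V \<in> carrier_mat n n. mat_adjoint V * V = 1\<^sub>m n}"

lemma mat_adjoint_index:
  assumes "A \<in> carrier_mat m n" "i < n" "j < m"
  shows "mat_adjoint A $$ (i, j) = conjugate (A $$ (j, i))"
  using assms by (simp add: mat_adjoint_def mat_of_rows_def)

lemma mat_adjoint_carrier: "A \<in> carrier_mat m n \<Longrightarrow> mat_adjoint A \<in> carrier_mat n m"
  by (simp add: mat_adjoint_def mat_of_rows_def)

lemma mat_adjoint_real: "mat_adjoint (A :: real mat) = transpose_mat A"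
  by (rule eq_matI) (auto simp: mat_adjoint_def mat_of_rows_def)

lemma unitary_matrices_real:
  "(unitary_matrices n :: real mat set) = {V \<in> carrier_mat n n. transpose_mat V * V = 1\<^sub>m n}"
  by (simp add: unitary_matrices_def mat_adjoint_real)

definition frobenius_norm :: "'a :: real_normed_vector mat \<Rightarrow> real" where
  "frobenius_norm A = sqrt (\<Sum>r<dim_row A. \<Sum>c<dim_col A. (norm (A $$ (r, c)))\<^sup>2)"

text \<open>The sum over \<open>i < k\<close> of the \<open>n\<close> by \<open>n\<close> matrices \<open>a i (b i)\<^sup>\<dagger>\<close>, entry by entry.\<close>

definition outer_sum ::
  "nat \<Rightarrow> nat \<Rightarrow> (nat \<Rightarrow> 'a :: conjugatable_field vec) \<Rightarrow> (nat \<Rightarrow> 'a vec) \<Rightarrow> 'a mat" where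
  "outer_sum n k a b = mat n n (\<lambda>(r, c). \<Sum>i<k. a i $ r * conjugate (b i $ c))"


section \<open>Algorithms in exact scalar arithmetic\<close>

text \<open>An algorithm is one program text, the same for all sizes and for all inputs. Programs act
  on natural-number registers, used for loop bounds and addresses, and on numbered two-dimensional
  arrays of scalars. The only scalar constants are 0 and 1, and scalars influence the control flow
  only through tests for zero. All loops are bounded, so every program terminates.\<close>

datatype iexp = Const nat | Reg nat | Plus iexp iexp | Minus iexp iexp

datatype sexp =
    Zero | One
  | Cell nat iexp iexp
  | Add sexp sexp | Sub sexp sexp | Mul sexp sexp | Div sexp sexp
  | Conj sexp | Sqrt sexp

datatype com =
    Skip
  | SetReg nat iexp
  | SetCell nat iexp iexp sexp
  | Seq com com
  | IfZero sexp com com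
  | IfLess iexp iexp com com
  | For nat iexp com
  | Eig iexp nat nat nat

record 'a state =
  reg :: "nat \<Rightarrow> nat"
  cell :: "nat \<Rightarrow> nat \<Rightarrow> nat \<Rightarrow> 'a"

primrec ival :: "iexp \<Rightarrow> 'a state \<Rightarrow> nat" where
  "ival (Const c) s = c"
| "ival (Reg x) s = reg s x"
| "ival (Plus e f) s = ival e s + ival f s"
| "ival (Minus e f) s = ival e s - ival f s"

text \<open>The parameter \<open>rt\<close> is the scalar square root: \<^const>\<open>csqrt\<close> for complex scalars and
  \<^const>\<open>sqrt\<close> for real ones. Division by zero returns zero, which a program could also arrange by
  a test.\<close>

primrec sval :: "('a \<Rightarrow> 'a) \<Rightarrow> sexp \<Rightarrow> 'a :: conjugatable_field state \<Rightarrow> 'a" where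
  "sval rt Zero s = 0"
| "sval rt One s = 1"
| "sval rt (Cell A e f) s = cell s A (ival e s) (ival f s)"
| "sval rt (Add p q) s = sval rt p s + sval rt q s"
| "sval rt (Sub p q) s = sval rt p s - sval rt q s"
| "sval rt (Mul p q) s = sval rt p s * sval rt q s"
| "sval rt (Div p q) s = sval rt p s / sval rt q s"
| "sval rt (Conj p) s = conjugate (sval rt p s)"
| "sval rt (Sqrt p) s = rt (sval rt p s)"

primrec ops :: "sexp \<Rightarrow> nat" where
  "ops Zero = 0"
| "ops One = 0"
| "ops (Cell A e f) = 0"
| "ops (Add p q) = ops p + ops q + 1"
| "ops (Sub p q) = ops p + ops q + 1"
| "ops (Mul p q) = ops p + ops q + 1"
| "ops (Div p q) = ops p + ops q + 1"
| "ops (Conj p) = ops p + 1"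
| "ops (Sqrt p) = ops p + 1"

definition set_reg :: "nat \<Rightarrow> nat \<Rightarrow> 'a state \<Rightarrow> 'a state" where
  "set_reg x v s = s\<lparr>reg := (reg s)(x := v)\<rparr>"

definition set_cell :: "nat \<Rightarrow> nat \<Rightarrow> nat \<Rightarrow> 'a \<Rightarrow> 'a state \<Rightarrow> 'a state" where
  "set_cell A i j v s = s\<lparr>cell := (cell s)(A := (cell s A)(i := (cell s A i)(j := v)))\<rparr>"

definition block :: "nat \<Rightarrow> nat \<Rightarrow> 'a state \<Rightarrow> 'a mat" where
  "block m A s = mat m m (\<lambda>(i, j). cell s A i j)"

definition set_block :: "nat \<Rightarrow> nat \<Rightarrow> 'a mat \<Rightarrow> 'a state \<Rightarrow> 'a state" where
  "set_block m A M s = s\<lparr>cell := (cell s)(A :=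
     (\<lambda>i j. if i < m \<and> j < m then M $$ (i, j) else cell s A i j))\<rparr>"

definition set_column :: "nat \<Rightarrow> nat \<Rightarrow> 'a vec \<Rightarrow> 'a state \<Rightarrow> 'a state" where
  "set_column m A v s = s\<lparr>cell := (cell s)(A :=
     (\<lambda>i j. if i < m \<and> j = 0 then v $ i else cell s A i j))\<rparr>"

text \<open>Eigendecompositions are not unique, so the primitive is an arbitrary function that returns
  for each Hermitian (over the reals: symmetric) matrix \<open>M\<close> some unitary \<open>Q\<close> and some vector \<open>d\<close> of
  eigenvalues with \<open>M = Q diag(d) Q\<^sup>\<dagger>\<close>. Nothing is promised for other matrices.\<close>

definition eigendecomposer :: "('a :: conjugatable_field mat \<Rightarrow> 'a mat \<times> 'a vec) \<Rightarrow> bool" where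
  "eigendecomposer eig \<longleftrightarrow>
     (\<forall>m. \<forall>M \<in> carrier_mat m m. mat_adjoint M = M \<longrightarrow>
        (\<exists>Q d. eig M = (Q, d) \<and> Q \<in> unitary_matrices m \<and> d \<in> carrier_vec m \<and>
           M = Q * mat_diag m (\<lambda>i. d $ i) * mat_adjoint Q))"

text \<open>The result of a run is the final state with the number of steps. Besides the scalar
  operations, every assignment, every test and every loop iteration counts as one step, and the
  eigendecomposition of an \<open>m\<close> by \<open>m\<close> matrix as \<open>m^3\<close> steps (another constant factor would only rescale the bound). A loop without
  iterations is free, so that a bound of zero steps can be met when there is nothing to do. The evaluation of the index expressions
  in one instruction is not counted separately: it takes a number of operations that is fixed by
  the program text. \<open>Eig e A Q D\<close> decomposes the leading \<open>m\<close> by \<open>m\<close> block of the array \<open>A\<close>, where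
  \<open>m\<close> is the value of \<open>e\<close>, into the leading block of \<open>Q\<close> and the column 0 of \<open>D\<close>.
  The bound of a loop is evaluated once, on entry.\<close>

primrec run :: "('a \<Rightarrow> 'a) \<Rightarrow> ('a mat \<Rightarrow> 'a mat \<times> 'a vec) \<Rightarrow> com \<Rightarrow>
    'a :: conjugatable_field state \<Rightarrow> 'a state \<times> nat" where
  "run rt eig Skip s = (s, 0)"
| "run rt eig (SetReg x e) s = (set_reg x (ival e s) s, 1)"
| "run rt eig (SetCell A e f p) s =
     (set_cell A (ival e s) (ival f s) (sval rt p s) s, ops p + 1)"
| "run rt eig (Seq P Q) s =
     (let (s', t) = run rt eig P s; (s'', t') = run rt eig Q s' in (s'', t + t'))"
| "run rt eig (IfZero p P Q) s =
     (let (s', t) = (if sval rt p s = 0 then run rt eig P s else run rt eig Q s)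
      in (s', t + ops p + 1))"
| "run rt eig (IfLess e f P Q) s =
     (let (s', t) = (if ival e s < ival f s then run rt eig P s else run rt eig Q s)
      in (s', t + 1))"
| "run rt eig (For x e P) s =
     fold (\<lambda>j (s', t). let (s'', t') = run rt eig P (set_reg x j s') in (s'', t + t' + 1))
       [0..<ival e s] (s, 0)"
| "run rt eig (Eig e A Q D) s =
     (let m = ival e s; (V, d) = eig (block m A s)
      in (set_column m D d (set_block m Q V s), m ^ 3))"

text \<open>Registers 0 and 1 hold \<open>n\<close> and \<open>k\<close>, array 0 holds \<open>U\<close>, and the vectors \<open>a i\<close> and \<open>b i\<close> are
  the columns of the arrays 1 and 2; all other storage is zero. The output overwrites \<open>U\<close>.\<close>

definition input_state ::
  "nat \<Rightarrow> nat \<Rightarrow> 'a :: zero mat \<Rightarrow> (nat \<Rightarrow> 'a vec) \<Rightarrow> (nat \<Rightarrow> 'a vec) \<Rightarrow> 'a state" where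
  "input_state n k U a b = \<lparr>
     reg = (\<lambda>x. if x = 0 then n else if x = 1 then k else 0),
     cell = (\<lambda>A i j.
       if A = 0 \<and> i < n \<and> j < n then U $$ (i, j)
       else if A = 1 \<and> i < n \<and> j < k then a j $ i
       else if A = 2 \<and> i < n \<and> j < k then b j $ i
       else 0)\<rparr>"

definition output_matrix :: "nat \<Rightarrow> 'a state \<Rightarrow> 'a mat" where
  "output_matrix n s = block n 0 s"

end

theory Submission
  imports Defs
begin

text \<open>Let \<open>Y\<close> consist of the \<open>2 k\<close> columns \<open>U\<^sup>\<dagger> a\<^sub>i\<close> and \<open>b\<^sub>i\<close>. An eigendecomposition of its Gram matrix
  gives a singular value decomposition \<open>Y = W S Q\<^sup>\<dagger>\<close>, in which zero columns of \<open>W\<close> stand for the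
  singular value 0. Then \<open>U + G = U (1 + W (M - 1) W\<^sup>\<dagger>)\<close> for a \<open>2 k\<close> by \<open>2 k\<close> matrix \<open>M\<close>, and if
  \<open>M = P H\<close> is a polar decomposition, then \<open>U (1 + W (P - 1) W\<^sup>\<dagger>)\<close> is a unitary polar factor of
  \<open>U + G\<close>, hence closest to it. The factor \<open>P\<close> is \<open>E Q'\<^sup>\<dagger>\<close> for a singular value
  decomposition \<open>M = E S' Q'\<^sup>\<dagger>\<close> whose zero columns of \<open>E\<close> have been filled up to a unitary matrix by
  normalized columns of the projection \<open>1 - E E\<^sup>\<dagger>\<close>. A loop with bound \<open>min k 1\<close> around everything
  makes the program free for \<open>k = 0\<close>.\<close>

section \<open>Matrices and polar factors\<close>

text \<open>The columns of \<open>Y\<close> are chosen because U + G = U (1 + sum of (U^H a_i)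
  b_i^H): the bracket differs from the identity by a map whose range and row space both lie in the
  span of \<open>Y\<close>, of dimension at most 2 k. All spectral work can thus be done on 2 k by 2
  k matrices, and matrices with n rows are only ever multiplied over at most 2 k rows or columns in
  one of the three index ranges. The obstacle is degeneracy. The columns of \<open>Y\<close> may be
  dependent, so \<open>W\<close> is only a partial isometry, and K -> 1 - W W^H + W K W^H respects
  products only for matrices K that act trivially on the zero columns of \<open>W\<close>.
  \<open>M\<close> does, but an arbitrary eigendecomposition of M^H M need not be adapted to these
  columns, and the completed factor P is not even determined by \<open>M\<close> if \<open>M\<close>
  is singular. It has to be shown that H, its square root and P still act trivially there. For
  singular U + G the minimizer is not unique and the inverse square root of A^H A does not exist.
  Optimality is therefore certified by a factorization A = V (R^H R) with V unitary, which covers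
  the invertible and the singular case alike.\<close>

notation mat_adjoint ("_\<^sup>H" [1000] 1000)

section \<open>Calculus of adjoints, products and diagonal matrices, with side conditions on
  dimensions that simplification can discharge\<close>

lemma mat_adjoint_dim [simp]:
  "dim_row A\<^sup>H = dim_col A" "dim_col A\<^sup>H = dim_row A"
  using mat_adjoint_carrier[of A "dim_row A" "dim_col A"] by auto

lemma mat_adjoint_index' [simp]:
  "i < dim_col A \<Longrightarrow> j < dim_row A \<Longrightarrow> A\<^sup>H $$ (i, j) = conjugate (A $$ (j, i))"
  by (rule mat_adjoint_index) auto

lemma mat_adjoint_adjoint [simp]: "A\<^sup>H\<^sup>H = A"
  by (rule eq_matI) auto

lemma conjugate_1 [simp]: "conjugate (1 :: 'a :: conjugatable_field) = 1"
proof -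
  have "conjugate (1 :: 'a) * conjugate 1 = conjugate 1"
    by (simp flip: conjugate_dist_mul)
  then show ?thesis
    by simp
qed

lemma mat_adjoint_one [simp]: "(1\<^sub>m n)\<^sup>H = (1\<^sub>m n :: 'a :: conjugatable_field mat)"
  by (rule eq_matI) auto

lemma mat_adjoint_diag: "(mat_diag n f)\<^sup>H = mat_diag n (\<lambda>i. conjugate (f i))"
  by (rule eq_matI) (auto simp: mat_diag_def)

lemma mat_adjoint_add:
  "dim_row A = dim_row B \<Longrightarrow> dim_col A = dim_col B \<Longrightarrow> (A + B)\<^sup>H = A\<^sup>H + B\<^sup>H"
  by (rule eq_matI) (auto simp: conjugate_dist_add)

lemma conjugate_diff: "conjugate (x - y :: 'a :: conjugatable_ring) = conjugate x - conjugate y"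
  using conjugate_dist_add[of x "- y"] by (simp add: conjugate_neg)

lemma mat_adjoint_minus:
  "dim_row A = dim_row B \<Longrightarrow> dim_col A = dim_col B \<Longrightarrow> (A - B)\<^sup>H = A\<^sup>H - B\<^sup>H"
  by (rule eq_matI) (auto simp: conjugate_diff)

lemma mult_mat_index:
  "i < dim_row A \<Longrightarrow> j < dim_col B \<Longrightarrow> dim_col A = dim_row B \<Longrightarrow>
    (A * B) $$ (i, j) = (\<Sum>l<dim_row B. A $$ (i, l) * B $$ (l, j))"
  by (simp add: scalar_prod_def atLeast0LessThan)

lemma mat_adjoint_mult:
  "dim_col A = dim_row B \<Longrightarrow> (A * B)\<^sup>H = B\<^sup>H * A\<^sup>H"
  by (rule eq_matI)
    (auto simp: mult_mat_index sum_conjugate conjugate_dist_mul mult.commute simp del: index_mult_mat(1))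

lemma mult_mat_assoc:
  fixes A :: "'a :: semiring_0 mat"
  shows "dim_col A = dim_row B \<Longrightarrow> dim_col B = dim_row C \<Longrightarrow> A * B * C = A * (B * C)"
  by (rule assoc_mult_mat) auto

lemma mult_mat_distrib:
  fixes A :: "'a :: ring mat"
  shows "dim_col A = dim_row B \<Longrightarrow> dim_row B = dim_row C \<Longrightarrow> dim_col B = dim_col C \<Longrightarrow>
      A * (B + C) = A * B + A * C"
    and "dim_col A = dim_row B \<Longrightarrow> dim_row B = dim_row C \<Longrightarrow> dim_col B = dim_col C \<Longrightarrow>
      A * (B - C) = A * B - A * C"
    and "dim_col B = dim_row D \<Longrightarrow> dim_row B = dim_row C \<Longrightarrow> dim_col B = dim_col C \<Longrightarrow>
      (B + C) * D = B * D + C * D"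
    and "dim_col B = dim_row D \<Longrightarrow> dim_row B = dim_row C \<Longrightarrow> dim_col B = dim_col C \<Longrightarrow>
      (B - C) * D = B * D - C * D"
     apply (rule mult_add_distrib_mat; auto)
    apply (rule mult_minus_distrib_mat; auto)
   apply (rule add_mult_distrib_mat; auto)
  apply (rule minus_mult_distrib_mat; auto)
  done

lemma mult_one_mat [simp]:
  fixes A :: "'a :: semiring_1 mat"
  shows "dim_row A = n \<Longrightarrow> 1\<^sub>m n * A = A" "dim_col A = n \<Longrightarrow> A * 1\<^sub>m n = A"
  by (auto intro: left_mult_one_mat right_mult_one_mat)

lemma mat_diag_dims [simp]: "dim_row (mat_diag n f) = n" "dim_col (mat_diag n f) = n"
  by (simp_all add: mat_diag_def)

lemma mult_mat_diag_index:
  fixes A :: "'a :: comm_semiring_1 mat"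
  shows "i < dim_row A \<Longrightarrow> j < n \<Longrightarrow> dim_col A = n \<Longrightarrow>
    (A * mat_diag n f) $$ (i, j) = A $$ (i, j) * f j"
  by (subst mat_diag_mult_right[of A "dim_row A" n]) auto

lemma mat_diag_mult_index:
  fixes A :: "'a :: comm_semiring_1 mat"
  shows "i < n \<Longrightarrow> j < dim_col A \<Longrightarrow> dim_row A = n \<Longrightarrow>
    (mat_diag n f * A) $$ (i, j) = f i * A $$ (i, j)"
  by (subst mat_diag_mult_left[of A n "dim_col A"]) auto

lemma mat_diag_index: "i < n \<Longrightarrow> j < n \<Longrightarrow> mat_diag n f $$ (i, j) = (if i = j then f i else 0)"
  by (simp add: mat_diag_def)

lemma mat_diag_cong: "(\<And>i. i < n \<Longrightarrow> f i = g i) \<Longrightarrow> mat_diag n f = mat_diag n g"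
  by (rule eq_matI) (auto simp: mat_diag_def)

lemma unitary_matricesD:
  assumes "V \<in> unitary_matrices n"
  shows "dim_row V = n" "dim_col V = n" "V\<^sup>H * V = 1\<^sub>m n" "V * V\<^sup>H = 1\<^sub>m n"
proof -
  have *: "V \<in> carrier_mat n n" "V\<^sup>H * V = 1\<^sub>m n"
    using assms by (auto simp: unitary_matrices_def)
  then show "dim_row V = n" "dim_col V = n" "V\<^sup>H * V = 1\<^sub>m n"
    by auto
  show "V * V\<^sup>H = 1\<^sub>m n"
    using mat_mult_left_right_inverse[OF mat_adjoint_carrier[OF *(1)] *] .
qed

lemma unitary_matricesI:
  "dim_row V = n \<Longrightarrow> dim_col V = n \<Longrightarrow> V\<^sup>H * V = 1\<^sub>m n \<Longrightarrow> V \<in> unitary_matrices n"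
  by (auto simp: unitary_matrices_def)

lemma unitary_cancel:
  assumes "V \<in> unitary_matrices n" "dim_row A = n"
  shows "V\<^sup>H * (V * A) = A" "V * (V\<^sup>H * A) = A"
  using unitary_matricesD[OF assms(1)] assms(2) by (simp_all flip: mult_mat_assoc)

section \<open>The trace, the Frobenius norm and minimality of polar factors\<close>

definition mat_trace :: "'a :: comm_monoid_add mat \<Rightarrow> 'a" where
  "mat_trace A = (\<Sum>i<dim_row A. A $$ (i, i))"

lemma mat_trace_minus:
  fixes A :: "'a :: ab_group_add mat"
  shows "dim_row A = dim_row B \<Longrightarrow> dim_col A = dim_row B \<Longrightarrow> dim_col B = dim_row B \<Longrightarrow>
    mat_trace (A - B) = mat_trace A - mat_trace B"
  by (simp add: mat_trace_def sum_subtractf)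

lemma mat_trace_mult_commute:
  fixes A :: "'a :: comm_semiring_0 mat"
  assumes "dim_col A = dim_row B" "dim_col B = dim_row A"
  shows "mat_trace (A * B) = mat_trace (B * A)"
proof -
  have "mat_trace (A * B) = (\<Sum>i<dim_row A. \<Sum>l<dim_row B. A $$ (i, l) * B $$ (l, i))"
    using assms by (auto simp: mat_trace_def mult_mat_index simp del: index_mult_mat(1))
  also have "\<dots> = (\<Sum>l<dim_row B. \<Sum>i<dim_row A. B $$ (l, i) * A $$ (i, l))"
    by (subst sum.swap) (simp add: mult.commute)
  also have "\<dots> = mat_trace (B * A)"
    using assms by (auto simp: mat_trace_def mult_mat_index simp del: index_mult_mat(1))
  finally show ?thesis .
qed

text \<open>What the real and the complex case share. \<open>rt\<close> is specified only at
  nonnegative reals: roots are taken only of eigenvalues of Gram matrices, of the roots of these,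
  and of diagonal entries of orthogonal projections.\<close>

locale scalars =
  fixes rt :: "'a \<Rightarrow> 'a :: {conjugatable_field, real_normed_field}"
  assumes mult_conjugate: "x * conjugate x = (of_real ((norm x)\<^sup>2) :: 'a)"
    and rt_of_real: "r \<ge> 0 \<Longrightarrow> rt (of_real r) = of_real (sqrt r)"
    and conjugate_of_real [simp]: "conjugate (of_real r) = (of_real r :: 'a)"
begin

lemma mat_trace_adjoint_mult:
  fixes A :: "'a mat"
  shows "mat_trace (A\<^sup>H * A) = of_real ((frobenius_norm A)\<^sup>2)"
proof -
  have "mat_trace (A\<^sup>H * A) = (\<Sum>c<dim_col A. \<Sum>r<dim_row A. of_real ((norm (A $$ (r, c)))\<^sup>2))"
    by (auto simp: mat_trace_def mult_mat_index mult_conjugate mult.commute[of "conjugate _"]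
        simp del: index_mult_mat(1) of_real_power intro!: sum.cong)
  also have "\<dots> = of_real (\<Sum>r<dim_row A. \<Sum>c<dim_col A. (norm (A $$ (r, c)))\<^sup>2)"
    by (subst sum.swap) simp
  also have "\<dots> = of_real ((frobenius_norm A)\<^sup>2)"
    unfolding frobenius_norm_def by (subst real_sqrt_pow2) (auto intro!: sum_nonneg)
  finally show ?thesis .
qed

text \<open>With \<open>Y = V\<^sup>\<dagger> V'\<close>, the norm grows from \<open>V\<close> to \<open>V'\<close> by exactly that of \<open>R (1 - Y)\<close>, because
  \<open>(1 - Y) (1 - Y)\<^sup>\<dagger> = 2 - Y - Y\<^sup>\<dagger>\<close>.\<close>

lemma polar_factor_is_arg_min:
  fixes A V R :: "'a mat"
  assumes V: "V \<in> unitary_matrices n" and R: "R \<in> carrier_mat n n" and A: "A = V * (R\<^sup>H * R)"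
  shows "is_arg_min (\<lambda>V. (frobenius_norm (A - V))\<^sup>2) (\<lambda>V. V \<in> unitary_matrices n) V"
proof -
  note dV = unitary_matricesD[OF V]
  have dR: "dim_row R = n" "dim_col R = n"
    using R by auto
  have dA: "dim_row A = n" "dim_col A = n"
    using dV dR A by auto
  define H where "H = R\<^sup>H * R"
  have dH: "dim_row H = n" "dim_col H = n" "H\<^sup>H = H"
    using dR by (auto simp: H_def mat_adjoint_mult)
  have "(frobenius_norm (A - V))\<^sup>2 \<le> (frobenius_norm (A - V'))\<^sup>2"
    if V': "V' \<in> unitary_matrices n" for V'
  proof -
    note dV' = unitary_matricesD[OF V']
    have expand: "mat_trace ((A - X)\<^sup>H * (A - X)) =
        mat_trace (A\<^sup>H * A) - mat_trace (A\<^sup>H * X) - (mat_trace (X\<^sup>H * A) - mat_trace (1\<^sub>m n))"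
      if "X \<in> unitary_matrices n" for X
      using unitary_matricesD[OF that] dA
      by (simp add: mat_adjoint_minus mult_mat_distrib mat_trace_minus)
    define Y where "Y = V\<^sup>H * V'"
    have dY: "dim_row Y = n" "dim_col Y = n"
      using dV dV' by (auto simp: Y_def)
    have YY: "Y * Y\<^sup>H = 1\<^sub>m n"
      using dV dV' by (simp add: Y_def mat_adjoint_mult mult_mat_assoc unitary_cancel[OF V'])
    have AV: "A\<^sup>H * V = H" "V\<^sup>H * A = H" "A\<^sup>H * V' = H * Y" "V'\<^sup>H * A = Y\<^sup>H * H"
      using dV dV' dH
      by (simp_all add: A mat_adjoint_mult mult_mat_assoc unitary_cancel[OF V] Y_def flip: H_def)
    define Z where "Z = R - R * Y"
    have "mat_trace (Z\<^sup>H * Z) = mat_trace H - mat_trace (H * Y)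
        - (mat_trace (Y\<^sup>H * H) - mat_trace (Y\<^sup>H * (H * Y)))"
      using dR dY
      by (simp add: Z_def H_def mat_adjoint_minus mat_adjoint_mult mult_mat_distrib mult_mat_assoc
          mat_trace_minus)
    also have "mat_trace (Y\<^sup>H * (H * Y)) = mat_trace H"
      using dH dY YY by (subst mat_trace_mult_commute) (auto simp: mult_mat_assoc)
    finally have "mat_trace ((A - V')\<^sup>H * (A - V')) =
        mat_trace ((A - V)\<^sup>H * (A - V)) + mat_trace (Z\<^sup>H * Z)"
      by (simp add: expand V V' AV)
    then have "(of_real ((frobenius_norm (A - V'))\<^sup>2) :: 'a) =
        of_real ((frobenius_norm (A - V))\<^sup>2 + (frobenius_norm Z)\<^sup>2)"
      by (simp add: mat_trace_adjoint_mult)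
    then have "(frobenius_norm (A - V'))\<^sup>2 = (frobenius_norm (A - V))\<^sup>2 + (frobenius_norm Z)\<^sup>2"
      by (simp only: of_real_eq_iff)
    then show ?thesis
      by simp
  qed
  then show ?thesis
    using V by (auto simp: is_arg_min_linorder)
qed

section \<open>Singular value decompositions from Gram matrices\<close>

lemma gram_diag_index:
  fixes A :: "'a mat"
  assumes "j < dim_col A"
  shows "(A\<^sup>H * A) $$ (j, j) = of_real (\<Sum>r<dim_row A. (norm (A $$ (r, j)))\<^sup>2)"
  using assms
  by (auto simp: mult_mat_index mult_conjugate mult.commute[of "conjugate _"]
      simp del: index_mult_mat(1) of_real_power)

text \<open>A vanishing sum of squared norms vanishes termwise. This is how positivity enters the
  matrix algebra: it turns a zero on the diagonal of a Gram matrix into a zero column.\<close>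

lemma gram_diag_zero:
  fixes A :: "'a mat"
  assumes "(A\<^sup>H * A) $$ (j, j) = 0" "j < dim_col A" "r < dim_row A"
  shows "A $$ (r, j) = 0"
proof -
  have "(\<Sum>r<dim_row A. (norm (A $$ (r, j)))\<^sup>2) = 0"
    using assms(1) by (simp only: gram_diag_index[OF assms(2)] of_real_eq_0_iff)
  then show ?thesis
    using assms(3) by (subst (asm) sum_nonneg_eq_0_iff) auto
qed

definition normalized_product :: "'a mat \<Rightarrow> 'a mat \<Rightarrow> (nat \<Rightarrow> 'a) \<Rightarrow> 'a mat" where
  "normalized_product Y Q d =
     mat (dim_row Y) (dim_col Q) (\<lambda>(i, j). (Y * Q) $$ (i, j) / rt (d j))"

text \<open>Where \<open>d\<close> vanishes, so does the column of \<open>Y Q\<close>, and the division by zero leaves a zero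
  column.\<close>

lemma normalized_product_svd:
  fixes Y Q :: "'a mat"
  assumes Q: "Q \<in> unitary_matrices m" and Y: "dim_col Y = m"
    and eig: "Y\<^sup>H * Y = Q * mat_diag m d * Q\<^sup>H"
  shows "\<And>j. j < m \<Longrightarrow> \<exists>r\<ge>0. d j = of_real r"
    and "(normalized_product Y Q d)\<^sup>H * normalized_product Y Q d =
      mat_diag m (\<lambda>j. if d j = 0 then 0 else 1)"
    and "Y = normalized_product Y Q d * mat_diag m (\<lambda>j. rt (d j)) * Q\<^sup>H"
proof -
  note dQ = unitary_matricesD[OF Q]
  define B where "B = Y * Q"
  have dB: "dim_row B = dim_row Y" "dim_col B = m"
    using dQ by (auto simp: B_def)
  \<comment> \<open>In the eigenbasis the columns of \<open>Y\<close> become orthogonal, so each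
    \<open>d j\<close> is the squared norm of a column of \<open>B\<close>.\<close>
  have BB: "B\<^sup>H * B = mat_diag m d"
  proof -
    have "B\<^sup>H * B = Q\<^sup>H * ((Y\<^sup>H * Y) * Q)"
      using dQ Y by (simp add: B_def mat_adjoint_mult mult_mat_assoc)
    then show ?thesis
      using dQ by (simp add: eig mult_mat_assoc unitary_cancel[OF Q])
  qed
  have d: "d j = of_real (\<Sum>r<dim_row Y. (norm (B $$ (r, j)))\<^sup>2)" if "j < m" for j
    using gram_diag_index[of j B] that by (simp add: BB dB mat_diag_index)
  then show real: "\<exists>r\<ge>0. d j = of_real r" if "j < m" for j
    using that by (intro exI[of _ "\<Sum>r<dim_row Y. (norm (B $$ (r, j)))\<^sup>2"]) (auto intro!: sum_nonneg)
  have rt0: "rt (d j) = 0 \<longleftrightarrow> d j = 0" and rtd: "rt (d j) * rt (d j) = d j"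
    and rtc: "conjugate (rt (d j)) = rt (d j)" if j: "j < m" for j
  proof -
    obtain r where r: "r \<ge> 0" "d j = of_real r"
      using real[OF j] by auto
    then have "rt (d j) = of_real (sqrt r)"
      by (simp add: rt_of_real)
    with r show "rt (d j) = 0 \<longleftrightarrow> d j = 0" "rt (d j) * rt (d j) = d j"
      "conjugate (rt (d j)) = rt (d j)"
      by (simp_all flip: of_real_mult)
  qed
  have B0: "B $$ (i, j) = 0" if "d j = 0" "i < dim_row Y" "j < m" for i j
    using gram_diag_zero[of B j i] that by (simp add: BB dB mat_diag_index)
  define W where "W = normalized_product Y Q d"
  have W: "W $$ (i, j) = B $$ (i, j) / rt (d j)" if "i < dim_row Y" "j < m" for i j
    using that dQ by (simp add: W_def normalized_product_def B_def)
  have dW: "dim_row W = dim_row Y" "dim_col W = m"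
    using dQ by (auto simp: W_def normalized_product_def)
  have "W\<^sup>H * W = mat_diag m (\<lambda>j. if d j = 0 then 0 else 1)"
  proof (rule eq_matI)
    fix i j assume "i < dim_row (mat_diag m (\<lambda>j. if d j = 0 then 0 else 1 :: 'a))"
      "j < dim_col (mat_diag m (\<lambda>j. if d j = 0 then 0 else 1 :: 'a))"
    then have ij: "i < m" "j < m"
      by auto
    have "(W\<^sup>H * W) $$ (i, j) =
        (\<Sum>r<dim_row Y. conjugate (B $$ (r, i)) * B $$ (r, j) / (rt (d i) * rt (d j)))"
    proof -
      \<comment> \<open>The divisor is self-conjugate; if it is 0, both quotients are 0 by the
        convention on division.\<close>
      have "conjugate (x / rt (d i)) = conjugate x / rt (d i)" for x
      proof (cases "rt (d i) = 0")
        case False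
        have "conjugate (x / rt (d i)) * rt (d i) = conjugate x"
          using False ij by (subst (2) rtc[symmetric]) (auto simp flip: conjugate_dist_mul)
        then show ?thesis
          using False by (simp add: field_simps)
      qed simp
      then show ?thesis
        using ij by (auto simp: mult_mat_index dW W simp del: index_mult_mat(1))
    qed
    also have "\<dots> = (B\<^sup>H * B) $$ (i, j) / (rt (d i) * rt (d j))"
      using ij by (simp add: mult_mat_index dB sum_divide_distrib del: index_mult_mat(1))
    finally show "(W\<^sup>H * W) $$ (i, j) = mat_diag m (\<lambda>j. if d j = 0 then 0 else 1) $$ (i, j)"
      using ij rtd by (simp add: BB mat_diag_index)
  qed (auto simp: dW)
  then show "(normalized_product Y Q d)\<^sup>H * normalized_product Y Q d =
      mat_diag m (\<lambda>j. if d j = 0 then 0 else 1)"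
    by (simp add: W_def)
  have "W * mat_diag m (\<lambda>j. rt (d j)) = B"
    using B0 rt0 by (intro eq_matI) (auto simp: dW dB mult_mat_diag_index W simp del: index_mult_mat(1))
  then have "W * mat_diag m (\<lambda>j. rt (d j)) * Q\<^sup>H = Y"
    using dQ Y by (simp add: B_def mult_mat_assoc)
  then show "Y = normalized_product Y Q d * mat_diag m (\<lambda>j. rt (d j)) * Q\<^sup>H"
    by (simp add: W_def)
qed

end

section \<open>Completion and compression\<close>

lemma mat_zero_rules [simp]:
  fixes A :: "'a :: ring mat"
  shows "dim_row A = n \<Longrightarrow> dim_col A = m \<Longrightarrow> A - A = 0\<^sub>m n m"
    and "dim_row A = n \<Longrightarrow> dim_col A = m \<Longrightarrow> A + 0\<^sub>m n m = A"
    and "dim_row A = n \<Longrightarrow> dim_col A = m \<Longrightarrow> 0\<^sub>m n m + A = A"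
    and "dim_row A = n \<Longrightarrow> dim_col A = m \<Longrightarrow> A - 0\<^sub>m n m = A"
  by (auto intro!: eq_matI)

context scalars
begin

text \<open>The entries of 1 - E E^H, given one by one because the program never forms this matrix:
  computing all of it anew for each missing column could cost m^4 in total, whereas its diagonal and
  a single column cost m^2 each time.\<close>

definition residual :: "nat \<Rightarrow> 'a mat \<Rightarrow> nat \<Rightarrow> nat \<Rightarrow> 'a" where
  "residual m E i p = (if i = p then 1 else 0) - (\<Sum>l<m. E $$ (i, l) * conjugate (E $$ (p, l)))"

text \<open>The divisor is the norm of column \<open>p\<close> of the projection N = 1 - E E^H:
  since N^H N = N, the squared norm of that column is the diagonal entry of N at
  \<open>p\<close>.\<close>

definition fill_column :: "nat \<Rightarrow> 'a mat \<Rightarrow> nat \<Rightarrow> nat \<Rightarrow> 'a mat" where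
  "fill_column m E j p =
     mat m m (\<lambda>(i, l). if l = j then residual m E i p / rt (residual m E p p) else E $$ (i, l))"

text \<open>Columns of \<open>E\<close> outside \<open>P\<close> have norm zero and hence vanish,
  which gives E E^H E = E. The projection identities follow from this.\<close>

lemma residual_projection:
  fixes E :: "'a mat"
  assumes E: "E \<in> carrier_mat m m" and EE: "E\<^sup>H * E = mat_diag m (\<lambda>l. if P l then 1 else 0)"
  defines "N \<equiv> 1\<^sub>m m - E * E\<^sup>H"
  shows "N\<^sup>H = N" "N * N = N" "E\<^sup>H * N = 0\<^sub>m m m"
    and "\<And>i p. i < m \<Longrightarrow> p < m \<Longrightarrow> N $$ (i, p) = residual m E i p"
proof -
  have dE: "dim_row E = m" "dim_col E = m"
    using E by auto
  have dN: "dim_row N = m" "dim_col N = m"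
    using dE by (auto simp: N_def)
  have E0: "E $$ (i, l) = 0" if "\<not> P l" "i < m" "l < m" for i l
    using gram_diag_zero[of E l i] that dE by (simp add: EE mat_diag_index)
  have EEE: "E * (E\<^sup>H * E) = E"
    unfolding EE using E0 dE
    by (intro eq_matI) (auto simp: mult_mat_diag_index simp del: index_mult_mat(1))
  have EEE': "E\<^sup>H * (E * E\<^sup>H) = E\<^sup>H"
    using arg_cong[OF EEE, of mat_adjoint] dE
    by (simp add: mat_adjoint_mult mult_mat_assoc)
  show "N\<^sup>H = N"
    using dE by (simp add: N_def mat_adjoint_minus mat_adjoint_mult)
  show EN: "E\<^sup>H * N = 0\<^sub>m m m"
    using dE by (simp add: N_def mult_mat_distrib EEE' )
  have "N * N = N - E * (E\<^sup>H * N)"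
    using dE dN by (subst (1) N_def) (simp add: mult_mat_distrib mult_mat_assoc)
  also have "\<dots> = N"
    using EN dE dN by (simp only:) (rule eq_matI; simp add: scalar_prod_def)
  finally show "N * N = N" .
  show "N $$ (i, p) = residual m E i p" if "i < m" "p < m" for i p
    using that dE by (auto simp: N_def residual_def mult_mat_index simp del: index_mult_mat(1))
qed

text \<open>Because N^H N = N, a zero diagonal of N = 1 - E E^H makes all columns of N zero. Then
  \<open>E\<close> would be unitary, contradicting its zero column \<open>j\<close>.\<close>

lemma residual_nonzero:
  fixes E :: "'a mat"
  assumes E: "E \<in> carrier_mat m m" and EE: "E\<^sup>H * E = mat_diag m (\<lambda>l. if P l then 1 else 0)"
    and j: "j < m" "\<not> P j"
  shows "\<exists>i<m. residual m E i i \<noteq> 0"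
proof (rule ccontr)
  assume *: "\<not> ?thesis"
  define N where "N = 1\<^sub>m m - E * E\<^sup>H"
  note N = residual_projection[OF E EE, folded N_def]
  have dE: "dim_row E = m" "dim_col E = m"
    using E by auto
  have dN: "dim_row N = m" "dim_col N = m"
    using dE by (auto simp: N_def)
  have N0: "N $$ (i, p) = 0" if "i < m" "p < m" for i p
    using gram_diag_zero[of N p i] * that dN by (simp add: N)
  have "E * E\<^sup>H = 1\<^sub>m m"
  proof (rule eq_matI)
    fix i p assume "i < dim_row (1\<^sub>m m :: 'a mat)" "p < dim_col (1\<^sub>m m :: 'a mat)"
    then have "i < m" "p < m"
      by auto
    then have "N $$ (i, p) = 1\<^sub>m m $$ (i, p) - (E * E\<^sup>H) $$ (i, p)"
      using dE by (simp add: N_def)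
    with N0[OF \<open>i < m\<close> \<open>p < m\<close>] show "(E * E\<^sup>H) $$ (i, p) = 1\<^sub>m m $$ (i, p)"
      by simp
  qed (use dE in auto)
  then have "E\<^sup>H * E = 1\<^sub>m m"
    using mat_mult_left_right_inverse[OF E mat_adjoint_carrier[OF E]] by simp
  then have "mat_diag m (\<lambda>l. if P l then 1 else 0 :: 'a) $$ (j, j) = 1\<^sub>m m $$ (j, j)"
    by (simp only: EE)
  then show False
    using j by (simp add: mat_diag_index)
qed

text \<open>The new column is orthogonal to the others because E^H N = 0, and it has norm 1 by the
  choice of the divisor.\<close>

lemma fill_column_gram:
  fixes E :: "'a mat"
  assumes E: "E \<in> carrier_mat m m" and EE: "E\<^sup>H * E = mat_diag m (\<lambda>l. if P l then 1 else 0)"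
    and j: "j < m" and p: "p < m" "residual m E p p \<noteq> 0"
  shows "(fill_column m E j p)\<^sup>H * fill_column m E j p =
    mat_diag m (\<lambda>l. if P l \<or> l = j then 1 else 0)"
proof -
  define N where "N = 1\<^sub>m m - E * E\<^sup>H"
  note N = residual_projection[OF E EE, folded N_def]
  have dE: "dim_row E = m" "dim_col E = m"
    using E by auto
  have dN: "dim_row N = m" "dim_col N = m"
    using dE by (auto simp: N_def)
  define F where "F = fill_column m E j p"
  define c where "c = residual m E p p"
  have dF: "dim_row F = m" "dim_col F = m"
    by (auto simp: F_def fill_column_def)
  have F: "F $$ (i, l) = (if l = j then N $$ (i, p) / rt c else E $$ (i, l))" if "i < m" "l < m" for i l
    using that p N(4) by (auto simp: F_def fill_column_def c_def)
  \<comment> \<open>As a diagonal entry of N^H N = N, \<open>c\<close> is a sum of squared norms, so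
    the specification of \<open>rt\<close> applies to it.\<close>
  obtain r where r: "r \<ge> 0" "c = of_real r"
    using gram_diag_index[of p N] p
    by (metis N(1,2) N(4) c_def dN(2) sum_nonneg zero_le_power2)
  have rt: "rt c = of_real (sqrt r)"
    using r by (simp add: rt_of_real)
  have cc: "rt c * rt c = c" "conjugate (rt c) = rt c" "c \<noteq> 0" "rt c \<noteq> 0"
    unfolding rt using r p by (auto simp: c_def simp flip: of_real_mult)
  have conj_div: "conjugate (x / rt c) = conjugate x / rt c" for x
    using conjugate_dist_mul[of "x / rt c" "rt c"] cc by (simp add: field_simps)
  have NN: "(\<Sum>i<m. conjugate (N $$ (i, p)) * N $$ (i, p)) = c"
  proof -
    have "(\<Sum>i<m. conjugate (N $$ (i, p)) * N $$ (i, p)) = (N\<^sup>H * N) $$ (p, p)"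
      using p dN by (auto simp: mult_mat_index simp del: index_mult_mat(1))
    then show ?thesis
      using p N by (simp add: c_def)
  qed
  have EN: "(\<Sum>i<m. conjugate (E $$ (i, l)) * N $$ (i, p)) = 0" if "l < m" for l
  proof -
    have "(\<Sum>i<m. conjugate (E $$ (i, l)) * N $$ (i, p)) = (E\<^sup>H * N) $$ (l, p)"
      using p dN dE that by (auto simp: mult_mat_index simp del: index_mult_mat(1))
    then show ?thesis
      using p N that by simp
  qed
  have NE: "(\<Sum>i<m. conjugate (N $$ (i, p)) * E $$ (i, l)) = 0" if "l < m" for l
    using arg_cong[OF EN[OF that], of conjugate]
    by (simp add: sum_conjugate conjugate_dist_mul mult.commute)
  have EEl: "(\<Sum>i<m. conjugate (E $$ (i, l)) * E $$ (i, q)) = (if l = q then if P l then 1 else 0 else 0)"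
    if "l < m" "q < m" for l q
  proof -
    have "(\<Sum>i<m. conjugate (E $$ (i, l)) * E $$ (i, q)) = (E\<^sup>H * E) $$ (l, q)"
      using dE that by (auto simp: mult_mat_index simp del: index_mult_mat(1))
    then show ?thesis
      using that by (auto simp: EE mat_diag_index)
  qed
  have "F\<^sup>H * F = mat_diag m (\<lambda>l. if P l \<or> l = j then 1 else 0)"
  proof (rule eq_matI)
    fix l q assume "l < dim_row (mat_diag m (\<lambda>l. if P l \<or> l = j then 1 else 0 :: 'a))"
      "q < dim_col (mat_diag m (\<lambda>l. if P l \<or> l = j then 1 else 0 :: 'a))"
    then have lq: "l < m" "q < m"
      by auto
    have "(F\<^sup>H * F) $$ (l, q) = (\<Sum>i<m. conjugate (F $$ (i, l)) * F $$ (i, q))"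
      using lq dF by (auto simp: mult_mat_index simp del: index_mult_mat(1))
    also have "\<dots> = mat_diag m (\<lambda>l. if P l \<or> l = j then 1 else 0) $$ (l, q)"
      using lq EEl[OF lq] EN[OF lq(1)] NE[OF lq(2)] NN cc
      by (cases "l = j"; cases "q = j")
        (simp_all add: F conj_div mat_diag_index flip: sum_divide_distrib)
    finally show "(F\<^sup>H * F) $$ (l, q) = mat_diag m (\<lambda>l. if P l \<or> l = j then 1 else 0) $$ (l, q)" .
  qed (auto simp: dF)
  then show ?thesis
    by (simp add: F_def)
qed

text \<open>The cross terms vanish by orthogonality of \<open>C\<close> and \<open>W\<close>. In the
  remaining product the inner W^H W need not be 1; commuting with \<open>K\<close>, it moves to the
  outer W^H and is absorbed there.\<close>

lemma compression_mult:
  fixes C W K L :: "'a mat"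
  assumes C: "C \<in> carrier_mat n n" "C * C = C" "C * W = 0\<^sub>m n m" "W\<^sup>H * C = 0\<^sub>m m n"
    and W: "W \<in> carrier_mat n m" "W * (W\<^sup>H * W) = W"
    and K: "K \<in> carrier_mat m m" "W\<^sup>H * W * K = K * (W\<^sup>H * W)" and L: "L \<in> carrier_mat m m"
  shows "(C + W * L * W\<^sup>H) * (C + W * K * W\<^sup>H) = C + W * (L * K) * W\<^sup>H"
proof -
  have d: "dim_row C = n" "dim_col C = n" "dim_row W = n" "dim_col W = m"
    "dim_row K = m" "dim_col K = m" "dim_row L = m" "dim_col L = m"
    using assms by auto
  have "W\<^sup>H * W * W\<^sup>H = W\<^sup>H"
    using arg_cong[OF W(2), of mat_adjoint] d by (simp add: mat_adjoint_mult mult_mat_assoc)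
  moreover have "W\<^sup>H * (W * (K * W\<^sup>H)) = W\<^sup>H * W * K * W\<^sup>H"
    using d by (simp add: mult_mat_assoc)
  ultimately have 1: "W\<^sup>H * (W * (K * W\<^sup>H)) = K * W\<^sup>H"
    unfolding K(2) using d by (simp add: mult_mat_assoc)
  have 2: "C * (W * (K * W\<^sup>H)) = 0\<^sub>m n n"
    using d C(3) by (simp flip: mult_mat_assoc)
  have 3: "W * (L * (W\<^sup>H * C)) = 0\<^sub>m n n"
    using d by (simp add: C(4))
  show ?thesis
    using d C(2) by (simp add: mult_mat_distrib mult_mat_assoc 1 2 3)
qed

text \<open>The two equations say that the rows and columns of \<open>K\<close> with index in
  \<open>z\<close> are those of the identity, so \<open>K\<close> is block diagonal for the
  splitting by \<open>z\<close>.\<close>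

lemma commute_if_trivial:
  fixes K :: "'a mat"
  assumes K: "K \<in> carrier_mat m m"
    and N: "N = mat_diag m (\<lambda>j. if z j then 1 else 0)" "N * K = N" "K * N = N"
  shows "mat_diag m (\<lambda>j. if z j then 0 else 1) * K = K * mat_diag m (\<lambda>j. if z j then 0 else 1)"
proof (rule eq_matI)
  have dK: "dim_row K = m" "dim_col K = m"
    using K by auto
  let ?J = "mat_diag m (\<lambda>j. if z j then 0 else 1 :: 'a)"
  fix i j assume "i < dim_row (K * ?J)" "j < dim_col (K * ?J)"
  then have ij: "i < m" "j < m"
    using dK by auto
  have "(N * K) $$ (i, j) = N $$ (i, j)" "(K * N) $$ (i, j) = N $$ (i, j)"
    by (simp_all only: N(2,3))
  then show "(?J * K) $$ (i, j) = (K * ?J) $$ (i, j)"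
    using ij dK
    by (auto simp: N(1) mat_diag_mult_index mult_mat_diag_index mat_diag_index
        simp del: index_mult_mat(1) split: if_splits)
qed (use K in auto)

text \<open>Each row of \<open>N * Q\<close> is fixed by \<open>mat_diag m d\<close>, so its nonzero
  entries sit where \<open>d j = 1\<close>, and there \<open>f\<close> gives 1 again. No relation
  between the eigenbasis \<open>Q\<close> and the splitting behind \<open>N\<close> is
  assumed.\<close>

lemma spectral_function_trivial:
  fixes M Q N :: "'a mat"
  assumes Q: "Q \<in> unitary_matrices m" and N: "N \<in> carrier_mat m m"
    and T: "N * (Q * mat_diag m d * Q\<^sup>H) = N" and f: "f 1 = 1"
  shows "N * (Q * mat_diag m (\<lambda>j. f (d j)) * Q\<^sup>H) = N"
proof -
  note dQ = unitary_matricesD[OF Q]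
  have dN: "dim_row N = m" "dim_col N = m"
    using N by auto
  have "N * Q = N * (Q * mat_diag m d * Q\<^sup>H) * Q"
    by (simp only: T)
  also have "\<dots> = (N * Q) * mat_diag m d"
    using dQ dN by (simp add: mult_mat_assoc)
  finally have NQ: "N * Q = N * Q * mat_diag m d" .
  have "(N * Q) $$ (i, j) = (N * Q) $$ (i, j) * d j" if "i < m" "j < m" for i j
  proof -
    have "(N * Q) $$ (i, j) = (N * Q * mat_diag m d) $$ (i, j)"
      by (rule arg_cong[OF NQ])
    then show ?thesis
      using that dQ dN by (simp add: mult_mat_diag_index del: index_mult_mat(1))
  qed
  then have *: "d j = 1 \<or> (N * Q) $$ (i, j) = 0" if "i < m" "j < m" for i j
    using that by (metis mult_cancel_left1)
  have "(N * Q) * mat_diag m (\<lambda>j. f (d j)) = N * Q"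
  proof (rule eq_matI)
    fix i j assume "i < dim_row (N * Q)" "j < dim_col (N * Q)"
    then have ij: "i < m" "j < m"
      using dQ dN by auto
    then show "(N * Q * mat_diag m (\<lambda>j. f (d j))) $$ (i, j) = (N * Q) $$ (i, j)"
      using *[OF ij] dQ dN f by (auto simp: mult_mat_diag_index simp del: index_mult_mat(1))
  qed (use dQ dN in auto)
  then have "(N * Q) * mat_diag m (\<lambda>j. f (d j)) * Q\<^sup>H = N * (Q * Q\<^sup>H)"
    using dQ dN by (simp add: mult_mat_assoc)
  then show ?thesis
    using dQ dN by (simp add: mult_mat_assoc)
qed

text \<open>With C = 1 - W W^H, the map \<open>F K = C + W * K * W\<^sup>H\<close> preserves
  adjoints, and products of matrices that act trivially on the indices in \<open>z\<close>. It
  therefore carries the polar decomposition of \<open>M\<close> to one of \<open>F M\<close>, and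
  \<open>U * F M\<close> is the matrix to be projected.\<close>

lemma closest_unitary_of_compression:
  fixes U W X B Q E :: "'a mat"
  assumes U: "U \<in> unitary_matrices n"
    and W: "W \<in> carrier_mat n m" "W\<^sup>H * W = mat_diag m (\<lambda>j. if z j then 0 else 1)"
    and X: "X \<in> carrier_mat m k" "\<And>i l. i < m \<Longrightarrow> z i \<Longrightarrow> l < k \<Longrightarrow> X $$ (i, l) = 0"
    and B: "B \<in> carrier_mat m k" "\<And>i l. i < m \<Longrightarrow> z i \<Longrightarrow> l < k \<Longrightarrow> B $$ (i, l) = 0"
    and M: "M = 1\<^sub>m m + X * B\<^sup>H"
    and Q: "Q \<in> unitary_matrices m" "M\<^sup>H * M = Q * mat_diag m d * Q\<^sup>H"
    and d: "\<And>j. j < m \<Longrightarrow> \<exists>r\<ge>0. d j = of_real r"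
    and E: "E \<in> unitary_matrices m" "M = E * mat_diag m (\<lambda>j. rt (d j)) * Q\<^sup>H"
  shows "is_arg_min (\<lambda>V. (frobenius_norm (U + U * (W * (X * B\<^sup>H) * W\<^sup>H) - V))\<^sup>2)
    (\<lambda>V. V \<in> unitary_matrices n) (U + U * W * (E * Q\<^sup>H - 1\<^sub>m m) * W\<^sup>H)"
proof -
  note dU = unitary_matricesD[OF U] and dQ = unitary_matricesD[OF Q(1)]
    and dE = unitary_matricesD[OF E(1)]
  have dim: "dim_row W = n" "dim_col W = m" "dim_row X = m" "dim_col X = k"
    "dim_row B = m" "dim_col B = k"
    using W X B by auto
  have dM: "dim_row M = m" "dim_col M = m"
    using dim by (auto simp: M)
  \<comment> \<open>\<open>N\<close> projects onto the indices of the zero columns of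
    \<open>W\<close>. \<open>X\<close> and \<open>B\<close> have zero rows there, so
    \<open>M\<close> acts as the identity on them from both sides.\<close>
  define N :: "'a mat" where "N = mat_diag m (\<lambda>j. if z j then 1 else 0)"
  have dN: "dim_row N = m" "dim_col N = m" and NH: "N\<^sup>H = N"
    by (auto simp: N_def mat_adjoint_diag intro!: mat_diag_cong)
  have N0: "N * Z = 0\<^sub>m m k"
    if "dim_row Z = m" "dim_col Z = k" "\<And>i l. i < m \<Longrightarrow> z i \<Longrightarrow> l < k \<Longrightarrow> Z $$ (i, l) = 0" for Z
    using that by (intro eq_matI) (auto simp: N_def mat_diag_mult_index simp del: index_mult_mat(1))
  have NX: "N * X = 0\<^sub>m m k" and NB: "N * B = 0\<^sub>m m k"
    using N0 X B dim by auto
  have zero: "(0\<^sub>m m k :: 'a mat)\<^sup>H = 0\<^sub>m k m"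
    by (rule eq_matI) auto
  have BN: "B\<^sup>H * N = 0\<^sub>m k m"
    using arg_cong[OF NB, of mat_adjoint] dN dim by (simp add: mat_adjoint_mult NH zero)
  have NM: "N * M = N"
    using dN dim NX by (simp add: M mult_mat_distrib flip: mult_mat_assoc)
  have MN: "M * N = N"
    using dN dim BN by (simp add: M mult_mat_distrib mult_mat_assoc)
  have MHN: "N * M\<^sup>H = N"
    using arg_cong[OF MN, of mat_adjoint] dN dM by (simp add: mat_adjoint_mult NH)
  have NT: "N * (Q * mat_diag m d * Q\<^sup>H) = N"
    using dN dM by (simp add: MHN NM flip: Q(2) mult_mat_assoc)
  have rt_real: "\<exists>r\<ge>0. rt x = of_real r \<and> rt x * rt x = x" if "\<exists>r\<ge>0. x = of_real r" for x
    using that by (auto simp: rt_of_real simp flip: of_real_mult)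
  then have rtd: "\<exists>r\<ge>0. rt (d j) = of_real r" "\<exists>r\<ge>0. rt (rt (d j)) = of_real r"
    "rt (rt (d j)) * rt (rt (d j)) = rt (d j)" if "j < m" for j
    using d[OF that] by meson+
  have "conjugate (rt (d j)) = rt (d j)" "conjugate (rt (rt (d j))) = rt (rt (d j))" if "j < m" for j
    using rtd[OF that] by auto
  note rtd = rtd(3) this
  have rt1: "rt 1 = 1"
    using rt_of_real[of 1] by simp
  define H where "H = Q * mat_diag m (\<lambda>j. rt (d j)) * Q\<^sup>H"
  \<comment> \<open>\<open>H\<close> is the square root of M^H M and \<open>R\<close> the square
    root of \<open>H\<close>: the fourth roots provide the positive factor in the form R^H R that
    the optimality criterion asks for.\<close>
  define R where "R = Q * mat_diag m (\<lambda>j. rt (rt (d j))) * Q\<^sup>H"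
  define P where "P = E * Q\<^sup>H"
  have dH: "dim_row H = m" "dim_col H = m" and dR: "dim_row R = m" "dim_col R = m"
    and dP: "dim_row P = m" "dim_col P = m"
    using dQ dE by (auto simp: H_def R_def P_def)
  have HH: "H\<^sup>H = H" and RH: "R\<^sup>H = R"
    using dQ rtd by (auto simp: H_def R_def mat_adjoint_mult mat_adjoint_diag mult_mat_assoc
        intro!: mat_diag_cong arg_cong[of _ _ "\<lambda>x. Q * (x * Q\<^sup>H)"])
  have RR: "R\<^sup>H * R = H"
  proof -
    have "R * R = Q * (mat_diag m (\<lambda>j. rt (rt (d j))) * mat_diag m (\<lambda>j. rt (rt (d j)))) * Q\<^sup>H"
      using dQ by (simp add: R_def mult_mat_assoc unitary_cancel[OF Q(1)] del: mat_diag_diag)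
    also have "mat_diag m (\<lambda>j. rt (rt (d j))) * mat_diag m (\<lambda>j. rt (rt (d j))) =
        mat_diag m (\<lambda>j. rt (d j))"
      using rtd by (auto intro!: mat_diag_cong)
    finally show ?thesis
      by (simp add: RH H_def)
  qed
  have NH': "N * H = N" and NR: "N * R = N"
    unfolding H_def R_def
    using spectral_function_trivial[OF Q(1) _ NT, of rt]
      spectral_function_trivial[OF Q(1) _ NT, of "\<lambda>x. rt (rt x)"] rt1 dN by auto
  have HN: "H * N = N" and RN: "R * N = N"
    using arg_cong[OF NH', of mat_adjoint] arg_cong[OF NR, of mat_adjoint] dN dH dR
    by (simp_all add: mat_adjoint_mult NH HH RH)
  have PH: "P * H = M"
    using dQ dE by (simp add: P_def H_def E(2) mult_mat_assoc unitary_cancel[OF Q(1)])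
  have P: "P\<^sup>H * P = 1\<^sub>m m"
    using dQ dE by (simp add: P_def mat_adjoint_mult mult_mat_assoc unitary_cancel[OF E(1)])
  \<comment> \<open>Even if \<open>P\<close> depends on the completion of \<open>E\<close>, its
    action on \<open>N\<close> does not: \<open>H * N = N\<close> gives P N = P H N = M N = N. The
    mirrored identity then uses that \<open>P\<close> is unitary.\<close>
  have PN: "P * N = N"
  proof -
    have "P * N = P * H * N"
      using dP dH dN HN by (simp add: mult_mat_assoc)
    then show ?thesis
      by (simp add: PH MN)
  qed
  have NPH: "N * P\<^sup>H = N"
    using arg_cong[OF PN, of mat_adjoint] dN dP by (simp add: mat_adjoint_mult NH)
  have NP: "N * P = N"
  proof -
    have "N * P = N * P\<^sup>H * P"
      by (simp only: NPH)
    then show ?thesis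
      using dP dN P by (simp add: mult_mat_assoc)
  qed
  define C where "C = 1\<^sub>m n - W * W\<^sup>H"
  have dC: "dim_row C = n" "dim_col C = n" "C\<^sup>H = C"
    using dim by (auto simp: C_def mat_adjoint_minus mat_adjoint_mult)
  have WWW: "W * (W\<^sup>H * W) = W"
  proof (rule eq_matI)
    fix i j assume "i < dim_row W" "j < dim_col W"
    then show "(W * (W\<^sup>H * W)) $$ (i, j) = W $$ (i, j)"
      using dim gram_diag_zero[of W j i]
      by (auto simp: W(2) mult_mat_diag_index mat_diag_index simp del: index_mult_mat(1))
  qed (use dim in auto)
  have WWW': "W\<^sup>H * (W * W\<^sup>H) = W\<^sup>H"
    using arg_cong[OF WWW, of mat_adjoint] dim by (simp add: mat_adjoint_mult mult_mat_assoc)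
  have CW: "C * W = 0\<^sub>m n m"
    using dim WWW by (simp add: C_def mult_mat_distrib mult_mat_assoc)
  have WC: "W\<^sup>H * C = 0\<^sub>m m n"
    using dim WWW' by (simp add: C_def mult_mat_distrib mult_mat_assoc)
  have CC: "C * C = C"
  proof -
    have "C * C = C - W * (W\<^sup>H * C)"
      using dim dC by (subst (1) C_def) (simp add: mult_mat_distrib mult_mat_assoc)
    then show ?thesis
      using dim dC WC by simp
  qed
  define F where "F K = C + W * K * W\<^sup>H" for K
  have dF: "dim_row (F K) = n" "dim_col (F K) = n" for K
    using dim by (auto simp: F_def)
  have F_mult: "F L * F K = F (L * K)"
    if "dim_row K = m" "dim_col K = m" "dim_row L = m" "dim_col L = m" "N * K = N" "K * N = N" for L K
    unfolding F_def
  proof (rule compression_mult)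
    show "W\<^sup>H * W * K = K * (W\<^sup>H * W)"
      unfolding W(2) using that by (intro commute_if_trivial[OF _ N_def]) auto
  qed (use that dim dC CC CW WC WWW in auto)
  have F_adjoint: "(F K)\<^sup>H = F (K\<^sup>H)" if "dim_row K = m" "dim_col K = m" for K
    using that dim dC by (simp add: F_def mat_adjoint_add mat_adjoint_mult mult_mat_assoc)
  \<comment> \<open>The left side is the form that the program evaluates, without ever forming
    \<open>C\<close>.\<close>
  have WK: "U + U * (W * (K - 1\<^sub>m m) * W\<^sup>H) = U * F K" if "dim_row K = m" "dim_col K = m" for K
    using that dim dU
    by (intro eq_matI)
      (auto simp: F_def C_def mult_mat_distrib mult_mat_assoc simp del: index_mult_mat(1))
  have F1: "F (1\<^sub>m m) = 1\<^sub>m n"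
    using dim by (intro eq_matI) (auto simp: F_def C_def simp del: index_mult_mat(1))
  have V: "U * F P \<in> unitary_matrices n"
  proof (rule unitary_matricesI)
    have "(U * F P)\<^sup>H * (U * F P) = (F P)\<^sup>H * F P"
      using dU dF by (simp add: mat_adjoint_mult mult_mat_assoc unitary_cancel[OF U])
    also have "\<dots> = 1\<^sub>m n"
      using dP NP PN by (simp add: F_adjoint F_mult P F1)
    finally show "(U * F P)\<^sup>H * (U * F P) = 1\<^sub>m n" .
  qed (use dU dF in auto)
  have "M - 1\<^sub>m m = X * B\<^sup>H"
    using dim by (intro eq_matI) (auto simp: M simp del: index_mult_mat(1))
  then have "U + U * (W * (X * B\<^sup>H) * W\<^sup>H) = U * F M"
    using WK[OF dM] by simp
  also have "\<dots> = U * F P * ((F R)\<^sup>H * F R)"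
    using dU dF dP dH dR NR RN NH' HN
    by (simp add: F_adjoint F_mult RR PH mult_mat_assoc)
  finally have A: "U + U * (W * (X * B\<^sup>H) * W\<^sup>H) = U * F P * ((F R)\<^sup>H * F R)" .
  have "U + U * W * (P - 1\<^sub>m m) * W\<^sup>H = U * F P"
    using WK[OF dP] dU dP dim by (simp add: mult_mat_assoc)
  then show ?thesis
    using polar_factor_is_arg_min[OF V carrier_matI[OF dF] A] by (simp add: P_def)
qed

end

section \<open>Program logic\<close>

definition agree :: "nat set \<Rightarrow> nat set \<Rightarrow> 'a state \<Rightarrow> 'a state \<Rightarrow> bool" where
  "agree As Rs s s' \<longleftrightarrow>
     (\<forall>A. A \<notin> As \<longrightarrow> cell s' A = cell s A) \<and> (\<forall>x. x \<notin> Rs \<longrightarrow> reg s' x = reg s x)"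

lemma agree_refl [simp]: "agree As Rs s s"
  by (simp add: agree_def)

lemma agree_set_reg [simp]: "x \<in> Rs \<Longrightarrow> agree As Rs s (set_reg x v s') \<longleftrightarrow> agree As Rs s s'"
  by (auto simp: agree_def set_reg_def)

lemma agree_set_cell [simp]: "A \<in> As \<Longrightarrow> agree As Rs s (set_cell A i j v s') \<longleftrightarrow> agree As Rs s s'"
  by (auto simp: agree_def set_cell_def)

lemma state_updates [simp]:
  "reg (set_reg x v s) = (reg s)(x := v)" "cell (set_reg x v s) = cell s"
  "reg (set_cell A i j w s) = reg s"
  "cell (set_cell A i j w s) = (cell s)(A := (cell s A)(i := (cell s A i)(j := w)))"
  by (simp_all add: set_reg_def set_cell_def)

definition stores :: "nat \<Rightarrow> 'a mat \<Rightarrow> 'a state \<Rightarrow> bool" where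
  "stores A M s \<longleftrightarrow> (\<forall>i<dim_row M. \<forall>j<dim_col M. cell s A i j = M $$ (i, j))"

lemma storesD: "stores A M s \<Longrightarrow> i < dim_row M \<Longrightarrow> j < dim_col M \<Longrightarrow> cell s A i j = M $$ (i, j)"
  by (simp add: stores_def)

text \<open>\<open>C\<^sub>i\<^sub>,\<^sub>h\<^sub>+\<^sub>j := (e + \<Sum>\<^sub>l\<^sub><\<^sub>r t) / f\<close> for \<open>i < p\<close> and \<open>j < q\<close>, where \<open>e\<close>, \<open>t\<close> and \<open>f\<close> find
  \<open>i\<close>, \<open>j\<close> and \<open>l\<close> in the registers 10, 11 and 12.\<close>

definition fill :: "nat \<Rightarrow> iexp \<Rightarrow> iexp \<Rightarrow> iexp \<Rightarrow> iexp \<Rightarrow> sexp \<Rightarrow> sexp \<Rightarrow> sexp \<Rightarrow> com" where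
  "fill C h p q r e t f =
     (let c = Cell C (Reg 10) (Plus h (Reg 11)); put = SetCell C (Reg 10) (Plus h (Reg 11)) in
      For 10 p (For 11 q (Seq (put e) (Seq (For 12 r (put (Add c t))) (put (Div c f))))))"

section \<open>Timed correctness rules for programs\<close>

locale machine = scalars rt for rt :: "'a \<Rightarrow> 'a :: {conjugatable_field, real_normed_field}" +
  fixes eig :: "'a mat \<Rightarrow> 'a mat \<times> 'a vec"
  assumes eig: "eigendecomposer eig"
begin

text \<open>A timed Hoare triple whose precondition is a single start state, so that preconditions
  become ordinary assumptions on \<open>s\<close>. Termination is built into
  \<open>run\<close>.\<close>

definition runs :: "com \<Rightarrow> 'a state \<Rightarrow> nat \<Rightarrow> ('a state \<Rightarrow> bool) \<Rightarrow> bool" where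
  "runs P s T Q \<longleftrightarrow> snd (run rt eig P s) \<le> T \<and> Q (fst (run rt eig P s))"

lemma runs_mono: "runs P s T Q \<Longrightarrow> T \<le> T' \<Longrightarrow> (\<And>s'. Q s' \<Longrightarrow> Q' s') \<Longrightarrow> runs P s T' Q'"
  by (auto simp: runs_def)

lemma runs_Skip: "Q s \<Longrightarrow> runs Skip s 0 Q"
  by (simp add: runs_def)

lemma runs_SetReg: "Q (set_reg x (ival e s) s) \<Longrightarrow> runs (SetReg x e) s 1 Q"
  by (simp add: runs_def)

lemma runs_SetCell:
  "Q (set_cell A (ival e s) (ival f s) (sval rt p s) s) \<Longrightarrow> runs (SetCell A e f p) s (ops p + 1) Q"
  by (simp add: runs_def)

lemma runs_Seq:
  "runs P s T Q \<Longrightarrow> (\<And>s'. Q s' \<Longrightarrow> runs P' s' T' Q') \<Longrightarrow> runs (Seq P P') s (T + T') Q'"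
  by (auto simp: runs_def split: prod.splits) (metis add_mono fst_conv snd_conv)+

lemma runs_IfZero:
  "(sval rt p s = 0 \<Longrightarrow> runs P s T Q) \<Longrightarrow> (sval rt p s \<noteq> 0 \<Longrightarrow> runs P' s T Q) \<Longrightarrow>
    runs (IfZero p P P') s (T + ops p + 1) Q"
  by (auto simp: runs_def split: prod.splits)

lemma runs_For:
  assumes N: "ival e s = N" and I: "I 0 s"
    and step: "\<And>j s'. j < N \<Longrightarrow> I j s' \<Longrightarrow> runs P (set_reg x j s') T (I (Suc j))"
  shows "runs (For x e P) s (N * (T + 1)) (I N)"
proof -
  define f where "f = (\<lambda>j (s', t). let (s'', t') = run rt eig P (set_reg x j s') in (s'', t + t' + 1))"
  have "snd (fold f [0..<j] (s, 0)) \<le> j * (T + 1) \<and> I j (fst (fold f [0..<j] (s, 0)))" if "j \<le> N" for j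
    using that
  proof (induction j)
    case 0
    then show ?case
      using I by simp
  next
    case (Suc j)
    obtain s' t where st: "fold f [0..<j] (s, 0) = (s', t)"
      by fastforce
    with Suc have "t \<le> j * (T + 1)" "I j s'"
      by auto
    moreover have "fold f [0..<Suc j] (s, 0) = f j (s', t)"
      by (simp add: st)
    ultimately show ?case
      using step[of j s'] Suc.prems by (auto simp: f_def runs_def split: prod.splits)
  qed
  from this[of N] show ?thesis
    by (simp add: runs_def N f_def)
qed

text \<open>The premise on \<open>sval\<close> ranges over all states that agree with
  \<open>s\<close> off \<open>C\<close> and the loop registers. So the values of \<open>e\<close>,
  \<open>t\<close> and \<open>f\<close> depend on the loop indices alone and not on the partly
  written target. The bound on \<open>np\<close> is separate because rows are iterated even if
  \<open>nq = 0\<close>.\<close>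

lemma runs_fill:
  assumes ival: "\<And>s'. agree {C} {10, 11, 12} s s' \<Longrightarrow>
      ival h s' = no \<and> ival p s' = np \<and> ival q s' = nq \<and> ival r s' = nr"
    and sval: "\<And>s'. agree {C} {10, 11, 12} s s' \<Longrightarrow>
      sval rt e s' = ev (reg s' 10) (reg s' 11) \<and>
      sval rt t s' = tv (reg s' 10) (reg s' 11) (reg s' 12) \<and>
      sval rt f s' = fv (reg s' 10) (reg s' 11)"
    and B: "np \<le> B" "np * nq \<le> B" "np * nq * nr \<le> B"
  shows "runs (fill C h p q r e t f) s ((ops e + ops t + ops f + 8) * B)
    (\<lambda>s'. agree {C} {10, 11, 12} s s' \<and>
      cell s' C = (\<lambda>i j. if i < np \<and> no \<le> j \<and> j < no + nq
        then (ev i (j - no) + (\<Sum>l<nr. tv i (j - no) l)) / fv i (j - no) else cell s C i j))"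
proof -
  define v where "v i j = (ev i j + (\<Sum>l<nr. tv i j l)) / fv i j" for i j
  \<comment> \<open>\<open>g i j\<close> is the target array once all positions before
    \<open>(i, j)\<close> in row-major order are final.\<close>
  define g where "g i j = (\<lambda>i' j'. if no \<le> j' \<and> j' < no + nq \<and> (i' < i \<or> i' = i \<and> j' < no + j)
      then v i' (j' - no) else cell s C i' j')" for i j
  let ?ag = "agree {C} {10, 11, 12} s"
  let ?put = "SetCell C (Reg 10) (Plus h (Reg 11))"
  let ?c = "Cell C (Reg 10) (Plus h (Reg 11))"
  have acc: "runs (For 12 r (?put (Add ?c t))) s1 (nr * (ops t + 3))
      (\<lambda>s'. ?ag s' \<and> reg s' 10 = i \<and> reg s' 11 = j \<and>
         cell s' C = (cell s1 C)(i := (cell s1 C i)(no + j := cell s1 C i (no + j) + (\<Sum>l<nr. tv i j l))))"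
    if s1: "?ag s1" "reg s1 10 = i" "reg s1 11 = j" for s1 i j
  proof -
    let ?I = "\<lambda>l s'. ?ag s' \<and> reg s' 10 = i \<and> reg s' 11 = j \<and>
      cell s' C = (cell s1 C)(i := (cell s1 C i)(no + j := cell s1 C i (no + j) + (\<Sum>l'<l. tv i j l')))"
    have "runs (For 12 r (?put (Add ?c t))) s1 (nr * (ops (Add ?c t) + 1 + 1)) (?I nr)"
    proof (rule runs_For[where I = ?I])
      show "ival r s1 = nr"
        using ival s1 by simp
      show "?I 0 s1"
        using s1 by simp
    next
      fix l s' assume "l < nr" and I: "?I l s'"
      have ag: "?ag (set_reg 12 l s')"
        using I by simp
      show "runs (?put (Add ?c t)) (set_reg 12 l s') (ops (Add ?c t) + 1) (?I (Suc l))"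
        using I ag ival[OF ag] sval[OF ag] by (intro runs_SetCell) (auto simp: add.assoc)
    qed
    then show ?thesis
      by (rule runs_mono) (auto simp: algebra_simps)
  qed
  let ?body = "Seq (?put e) (Seq (For 12 r (?put (Add ?c t))) (?put (Div ?c f)))"
  let ?T = "ops e + 1 + (nr * (ops t + 3) + (ops f + 2))"
  have body: "runs ?body s1 ?T (\<lambda>s'. ?ag s' \<and> reg s' 10 = i \<and> cell s' C = g i (Suc j))"
    if s1: "?ag s1" "reg s1 10 = i" "reg s1 11 = j" "cell s1 C = g i j" and j: "j < nq" for s1 i j
  proof (rule runs_Seq)
    show "runs (?put e) s1 (ops e + 1) (\<lambda>s'. ?ag s' \<and> reg s' 10 = i \<and> reg s' 11 = j \<and>
        cell s' C = (g i j)(i := (g i j i)(no + j := ev i j)))"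
      using s1 ival[OF s1(1)] sval[OF s1(1)] by (intro runs_SetCell) auto
  next
    fix s2 assume s2: "?ag s2 \<and> reg s2 10 = i \<and> reg s2 11 = j \<and>
        cell s2 C = (g i j)(i := (g i j i)(no + j := ev i j))"
    show "runs (Seq (For 12 r (?put (Add ?c t))) (?put (Div ?c f))) s2 (nr * (ops t + 3) + (ops f + 2))
        (\<lambda>s'. ?ag s' \<and> reg s' 10 = i \<and> cell s' C = g i (Suc j))"
    proof (rule runs_Seq[OF acc])
      fix s3 assume s3: "?ag s3 \<and> reg s3 10 = i \<and> reg s3 11 = j \<and> cell s3 C =
        (cell s2 C)(i := (cell s2 C i)(no + j := cell s2 C i (no + j) + (\<Sum>l<nr. tv i j l)))"
      then have ag: "?ag s3"
        by simp
      have "(g i j)(i := (g i j i)(no + j := v i j)) = g i (Suc j)"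
        using j by (auto simp: g_def fun_eq_iff)
      then have "runs (?put (Div ?c f)) s3 (ops (Div ?c f) + 1)
          (\<lambda>s'. ?ag s' \<and> reg s' 10 = i \<and> cell s' C = g i (Suc j))"
        using s2 s3 ival[OF ag] sval[OF ag] by (intro runs_SetCell) (auto simp: v_def)
      then show "runs (?put (Div ?c f)) s3 (ops f + 2)
          (\<lambda>s'. ?ag s' \<and> reg s' 10 = i \<and> cell s' C = g i (Suc j))"
        by (rule runs_mono) auto
    qed (use s2 in auto)
  qed
  have row: "runs (For 11 q ?body) s1 (nq * (?T + 1)) (\<lambda>s'. ?ag s' \<and> cell s' C = g (Suc i) 0)"
    if s1: "?ag s1" "reg s1 10 = i" "cell s1 C = g i 0" for s1 i
  proof -
    let ?I = "\<lambda>j s'. ?ag s' \<and> reg s' 10 = i \<and> cell s' C = g i j"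
    have "runs (For 11 q ?body) s1 (nq * (?T + 1)) (?I nq)"
    proof (rule runs_For[where I = ?I])
      show "ival q s1 = nq" "?I 0 s1"
        using s1 ival[OF s1(1)] by auto
      show "runs ?body (set_reg 11 j s') ?T (?I (Suc j))" if "j < nq" "?I j s'" for j s'
        using that by (intro body) auto
    qed
    moreover have "g i nq = g (Suc i) 0"
      by (auto simp: g_def fun_eq_iff less_Suc_eq)
    ultimately show ?thesis
      by (auto elim: runs_mono)
  qed
  let ?I = "\<lambda>i s'. ?ag s' \<and> cell s' C = g i 0"
  have "runs (For 10 p (For 11 q ?body)) s (np * (nq * (?T + 1) + 1)) (?I np)"
  proof (rule runs_For[where I = ?I])
    show "ival p s = np" "?I 0 s"
      using ival[of s] by (auto simp: g_def fun_eq_iff)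
    show "runs (For 11 q ?body) (set_reg 10 i s') (nq * (?T + 1)) (?I (Suc i))"
      if "i < np" "?I i s'" for i s'
      using that by (intro row) auto
  qed
  then show ?thesis
    unfolding fill_def Let_def
  proof (rule runs_mono)
    \<comment> \<open>The 8 is 1 + 4 + 3: one iteration step per row; per entry an iteration step,
      two assignments and a division; per summand an iteration step, an assignment and an
      addition.\<close>
    have "np * (nq * (?T + 1) + 1) =
        np + (ops e + ops f + 4) * (np * nq) + (ops t + 3) * (np * nq * nr)"
      by (simp add: algebra_simps)
    also have "\<dots> \<le> B + (ops e + ops f + 4) * B + (ops t + 3) * B"
      by (intro add_mono mult_le_mono2 B)
    also have "\<dots> = (ops e + ops t + ops f + 8) * B"
      by (simp add: algebra_simps)
    finally show "np * (nq * (?T + 1) + 1) \<le> (ops e + ops t + ops f + 8) * B" .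
  qed (auto simp: g_def v_def fun_eq_iff)
qed

lemma runs_fill_mat:
  assumes "\<And>s'. agree {C} {10, 11, 12} s s' \<Longrightarrow>
      ival p s' = np \<and> ival q s' = nq \<and> ival r s' = nr"
    and "\<And>s'. agree {C} {10, 11, 12} s s' \<Longrightarrow>
      sval rt e s' = ev (reg s' 10) (reg s' 11) \<and>
      sval rt t s' = tv (reg s' 10) (reg s' 11) (reg s' 12) \<and>
      sval rt f s' = fv (reg s' 10) (reg s' 11)"
    and "np \<le> B" "np * nq \<le> B" "np * nq * nr \<le> B"
    and "dim_row M = np" "dim_col M = nq"
    and "\<And>i j. i < np \<Longrightarrow> j < nq \<Longrightarrow> (ev i j + (\<Sum>l<nr. tv i j l)) / fv i j = M $$ (i, j)"
  shows "runs (fill C (Const 0) p q r e t f) s ((ops e + ops t + ops f + 8) * B)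
    (\<lambda>s'. agree {C} {10, 11, 12} s s' \<and> stores C M s')"
proof (rule runs_mono)
  show "runs (fill C (Const 0) p q r e t f) s ((ops e + ops t + ops f + 8) * B)
    (\<lambda>s'. agree {C} {10, 11, 12} s s' \<and>
      cell s' C = (\<lambda>i j. if i < np \<and> 0 \<le> j \<and> j < 0 + nq
        then (ev i (j - 0) + (\<Sum>l<nr. tv i (j - 0) l)) / fv i (j - 0) else cell s C i j))"
    by (rule runs_fill) (use assms in simp_all)
qed (use assms in \<open>auto simp: stores_def\<close>)

lemma runs_Eig:
  "eig (block (ival e s) A s) = (V, d) \<Longrightarrow>
    Q' (set_column (ival e s) D d (set_block (ival e s) Q V s)) \<Longrightarrow>
    runs (Eig e A Q D) s (ival e s ^ 3) Q'"
  by (simp add: runs_def Let_def)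

end

text \<open>Register \<open>x\<close> holds the number of rows and register 3 that of columns. The
  singular values are not stored; later code takes roots of the entries of \<open>D\<close> where it
  needs them.\<close>

definition svd :: "nat \<Rightarrow> nat \<Rightarrow> nat \<Rightarrow> nat \<Rightarrow> nat \<Rightarrow> nat \<Rightarrow> com" where
  "svd x Y S Q D W =
    Seq (fill S (Const 0) (Reg 3) (Reg 3) (Reg x) Zero
      (Mul (Conj (Cell Y (Reg 12) (Reg 10))) (Cell Y (Reg 12) (Reg 11))) One)
    (Seq (Eig (Reg 3) S Q D)
    (fill W (Const 0) (Reg x) (Reg 3) (Reg 3) Zero
      (Mul (Cell Y (Reg 10) (Reg 12)) (Cell Q (Reg 12) (Reg 11)))
      (Sqrt (Cell D (Reg 11) (Const 0)))))"

text \<open>Arrays 9, 12 and 13 hold the identity, the eigenvalues and \<open>E\<close>. Register 6 receives some \<open>p\<close>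
  with a nonzero diagonal entry of \<open>1 - E E\<^sup>\<dagger>\<close> (array 14). Column \<open>p\<close> of this matrix is normalized in
  array 15, since the columns of \<open>E\<close> are still being read, and then becomes column \<open>j\<close> of \<open>E\<close>.\<close>

definition complete_unitary :: com where
  "complete_unitary =
    For 4 (Reg 3) (IfZero (Cell 12 (Reg 4) (Const 0))
      (Seq (fill 14 (Const 0) (Reg 3) (Const 1) (Reg 3) One
        (Sub Zero (Mul (Cell 13 (Reg 10) (Reg 12)) (Conj (Cell 13 (Reg 10) (Reg 12))))) One)
      (Seq (For 5 (Reg 3) (IfZero (Cell 14 (Reg 5) (Const 0)) Skip (SetReg 6 (Reg 5))))
      (Seq (fill 15 (Const 0) (Reg 3) (Const 1) (Reg 3) (Cell 9 (Reg 10) (Reg 6))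
        (Sub Zero (Mul (Cell 13 (Reg 10) (Reg 12)) (Conj (Cell 13 (Reg 6) (Reg 12)))))
        (Sqrt (Cell 14 (Reg 6) (Const 0))))
      (fill 13 (Reg 4) (Reg 3) (Const 1) (Const 0) (Cell 15 (Reg 10) (Reg 11)) Zero One))))
      Skip)"

section \<open>Correctness and cost of the decomposition and of the completion\<close>

context machine
begin

text \<open>The 21 is 10 + 1 + 10: each of the two products has two scalar operations besides the 8
  of the loops, and the eigendecomposition takes at most \<open>B\<close> steps.\<close>

lemma runs_svd:
  fixes A V :: "'a mat"
  assumes A: "stores Y A s" "dim_row A = np" "dim_col A = m"
    and V: "eig (A\<^sup>H * A) = (V, d)" "dim_row V = m" "dim_col V = m"
    and m: "reg s 3 = m"
    and p: "reg s x = np" "x \<notin> {10, 11, 12}"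
    and dist: "distinct [Y, S, Q, D, W]"
    and B: "np \<le> B" "np * m \<le> B" "np * m * m \<le> B" "m \<le> B" "m * m \<le> B" "m * m * m \<le> B"
  shows "runs (svd x Y S Q D W) s (21 * B)
    (\<lambda>s'. agree {S, Q, D, W} {10, 11, 12} s s' \<and> stores Q V s' \<and>
      (\<forall>j<m. cell s' D j 0 = d $ j) \<and> stores W (normalized_product A V (\<lambda>j. d $ j)) s')"
proof -
  have "runs (svd x Y S Q D W) s (10 * B + (m ^ 3 + 10 * B))
    (\<lambda>s'. agree {S, Q, D, W} {10, 11, 12} s s' \<and> stores Q V s' \<and>
      (\<forall>j<m. cell s' D j 0 = d $ j) \<and> stores W (normalized_product A V (\<lambda>j. d $ j)) s')"
    unfolding svd_def
  proof (rule runs_Seq)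
    let ?P = "fill S (Const 0) (Reg 3) (Reg 3) (Reg x) Zero
      (Mul (Conj (Cell Y (Reg 12) (Reg 10))) (Cell Y (Reg 12) (Reg 11))) One"
    let ?t = "\<lambda>i j l. conjugate (cell s Y l i) * cell s Y l j"
    have "runs ?P s ((ops Zero + ops (Mul (Conj (Cell Y (Reg 12) (Reg 10))) (Cell Y (Reg 12) (Reg 11)))
        + ops One + 8) * B)
      (\<lambda>s'. agree {S} {10, 11, 12} s s' \<and> stores S (A\<^sup>H * A) s')"
      using A m p dist B
      by (intro runs_fill_mat[where ev = "\<lambda>_ _. 0" and tv = ?t and fv = "\<lambda>_ _. 1"
            and np = m and nq = m and nr = np])
        (auto simp: agree_def mult_mat_index storesD mult.commute mult.left_commute
          simp del: index_mult_mat(1))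
    then show "runs ?P s (10 * B) (\<lambda>s'. agree {S} {10, 11, 12} s s' \<and> stores S (A\<^sup>H * A) s')"
      by simp
  next
    fix s1 assume s1: "agree {S} {10, 11, 12} s s1 \<and> stores S (A\<^sup>H * A) s1"
    let ?P = "fill W (Const 0) (Reg x) (Reg 3) (Reg 3) Zero
      (Mul (Cell Y (Reg 10) (Reg 12)) (Cell Q (Reg 12) (Reg 11))) (Sqrt (Cell D (Reg 11) (Const 0)))"
    let ?I = "\<lambda>s'. agree {S, Q, D} {10, 11, 12} s s' \<and> stores Q V s' \<and> (\<forall>j<m. cell s' D j 0 = d $ j)"
    have m1: "reg s1 3 = m"
      using s1 m by (simp add: agree_def)
    have block: "block m S s1 = A\<^sup>H * A"
      using s1 A by (intro eq_matI) (auto simp: block_def storesD simp del: index_mult_mat(1))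
    show "runs (Seq (Eig (Reg 3) S Q D) ?P) s1 (m ^ 3 + 10 * B)
      (\<lambda>s'. agree {S, Q, D, W} {10, 11, 12} s s' \<and> stores Q V s' \<and>
        (\<forall>j<m. cell s' D j 0 = d $ j) \<and> stores W (normalized_product A V (\<lambda>j. d $ j)) s')"
    proof (rule runs_Seq)
      have "runs (Eig (Reg 3) S Q D) s1 (ival (Reg 3) s1 ^ 3) ?I"
        using s1 V dist m1
        by (intro runs_Eig[where V = V and d = d])
          (auto simp: block set_column_def set_block_def agree_def stores_def)
      then show "runs (Eig (Reg 3) S Q D) s1 (m ^ 3) ?I"
        by (simp add: m1)
    next
      fix s2 assume s2: "?I s2"
      then have Y2: "stores Y A s2"
        using A dist by (simp add: agree_def stores_def)
      let ?t = "\<lambda>i j l. cell s2 Y i l * cell s2 Q l j"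
      have "runs ?P s2 ((ops Zero + ops (Mul (Cell Y (Reg 10) (Reg 12)) (Cell Q (Reg 12) (Reg 11)))
          + ops (Sqrt (Cell D (Reg 11) (Const 0))) + 8) * B)
        (\<lambda>s'. agree {W} {10, 11, 12} s2 s' \<and> stores W (normalized_product A V (\<lambda>j. d $ j)) s')"
        using A V m p dist B s2 Y2
        by (intro runs_fill_mat[where ev = "\<lambda>_ _. 0" and tv = ?t
              and fv = "\<lambda>i j. rt (cell s2 D j 0)" and np = np and nq = m and nr = m])
          (auto simp: agree_def mult_mat_index storesD normalized_product_def simp del: index_mult_mat(1))
      then show "runs ?P s2 (10 * B) (\<lambda>s'. agree {S, Q, D, W} {10, 11, 12} s s' \<and> stores Q V s' \<and>
        (\<forall>j<m. cell s' D j 0 = d $ j) \<and> stores W (normalized_product A V (\<lambda>j. d $ j)) s')"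
        by (rule runs_mono) (use s2 dist in \<open>auto simp: agree_def stores_def\<close>)
    qed
  qed
  then show ?thesis
    by (rule runs_mono) (use B in \<open>auto simp: power3_eq_cube\<close>)
qed

text \<open>After \<open>j\<close> rounds the columns \<open>l\<close> with
  \<open>d l \<noteq> 0\<close> or \<open>l < j\<close> are orthonormal and the others zero. A round
  takes at most 34 m^2 steps (11 for the diagonal of the projection, 3 for the search, 12 for the
  new column, 8 for copying it), and the tests and iterations add 2 m in total.\<close>

lemma runs_complete_unitary:
  fixes E :: "'a mat" and d :: "nat \<Rightarrow> 'a"
  assumes E: "E \<in> carrier_mat m m" "E\<^sup>H * E = mat_diag m (\<lambda>l. if d l = 0 then 0 else 1)"
    and s: "stores 13 E s" "stores 9 (1\<^sub>m m) s" "\<And>j. j < m \<Longrightarrow> cell s 12 j 0 = d j" "reg s 3 = m"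
    and B: "m * m * m \<le> B"
  shows "runs complete_unitary s (36 * B)
    (\<lambda>s'. agree {13, 14, 15} {4, 5, 6, 10, 11, 12} s s' \<and>
      (\<exists>F \<in> unitary_matrices m. stores 13 F s' \<and>
        (\<forall>i<m. \<forall>l<m. d l \<noteq> 0 \<longrightarrow> F $$ (i, l) = E $$ (i, l))))"
proof -
  let ?ag = "agree {13, 14, 15} {4, 5, 6, 10, 11, 12} s"
  let ?inv = "\<lambda>j F. F \<in> carrier_mat m m \<and>
    F\<^sup>H * F = mat_diag m (\<lambda>l. if d l \<noteq> 0 \<or> l < j then 1 else 0) \<and>
    (\<forall>i<m. \<forall>l<m. d l \<noteq> 0 \<longrightarrow> F $$ (i, l) = E $$ (i, l))"
  let ?I = "\<lambda>j s'. ?ag s' \<and> (\<exists>F. stores 13 F s' \<and> ?inv j F)"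
  define P1 where "P1 = fill 14 (Const 0) (Reg 3) (Const 1) (Reg 3) One
    (Sub Zero (Mul (Cell 13 (Reg 10) (Reg 12)) (Conj (Cell 13 (Reg 10) (Reg 12))))) One"
  define P2 where "P2 = For 5 (Reg 3) (IfZero (Cell 14 (Reg 5) (Const 0)) Skip (SetReg 6 (Reg 5)))"
  define P3 where "P3 = fill 15 (Const 0) (Reg 3) (Const 1) (Reg 3) (Cell 9 (Reg 10) (Reg 6))
    (Sub Zero (Mul (Cell 13 (Reg 10) (Reg 12)) (Conj (Cell 13 (Reg 6) (Reg 12)))))
    (Sqrt (Cell 14 (Reg 6) (Const 0)))"
  define P4 where "P4 = fill 13 (Reg 4) (Reg 3) (Const 1) (Const 0) (Cell 15 (Reg 10) (Reg 11)) Zero One"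
  have step: "runs (Seq P1 (Seq P2 (Seq P3 P4))) s1 (34 * (m * m)) (?I (Suc j))"
    if j: "j < m" "d j = 0" and s1: "?ag s1" "reg s1 4 = j" "stores 13 F s1" "?inv j F" for s1 j F
  proof -
    have dF: "dim_row F = m" "dim_col F = m"
      using s1 by auto
    have mm: "m \<le> m * m"
      by simp
    have r1: "reg s1 3 = m"
      using s1(1) s(4) by (simp add: agree_def)
    have "runs P1 s1 ((ops One + ops (Sub Zero (Mul (Cell 13 (Reg 10) (Reg 12))
        (Conj (Cell 13 (Reg 10) (Reg 12))))) + ops One + 8) * (m * m))
      (\<lambda>s'. agree {14} {10, 11, 12} s1 s' \<and> stores 14 (mat m 1 (\<lambda>(i, j). residual m F i i)) s')"
      unfolding P1_def
      using r1 s1(3) dF mm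
      by (intro runs_fill_mat[where ev = "\<lambda>_ _. 1" and fv = "\<lambda>_ _. 1" and nr = m
            and tv = "\<lambda>i j l. 0 - cell s1 13 i l * conjugate (cell s1 13 i l)"])
        (auto simp: agree_def storesD residual_def sum_negf)
    then have P1: "runs P1 s1 (11 * (m * m))
      (\<lambda>s'. agree {14} {10, 11, 12} s1 s' \<and> (\<forall>i<m. cell s' 14 i 0 = residual m F i i))"
      by (rule runs_mono) (auto simp: stores_def)
    have P2: "runs P2 s2 (3 * (m * m))
      (\<lambda>s'. agree {} {5, 6} s2 s' \<and> reg s' 6 < m \<and> residual m F (reg s' 6) (reg s' 6) \<noteq> 0)"
      if s2: "agree {14} {10, 11, 12} s1 s2" "\<forall>i<m. cell s2 14 i 0 = residual m F i i" for s2
    proof -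
      \<comment> \<open>The search keeps the last nonzero diagonal entry. Register 6 may hold a
        stale value until one is found, hence the implication.\<close>
      let ?J = "\<lambda>i s'. agree {} {5, 6} s2 s' \<and> ((\<exists>i'<i. residual m F i' i' \<noteq> 0) \<longrightarrow>
          reg s' 6 < m \<and> residual m F (reg s' 6) (reg s' 6) \<noteq> 0)"
      have "runs P2 s2 (m * (1 + ops (Cell 14 (Reg 5) (Const 0)) + 1 + 1)) (?J m)"
        unfolding P2_def
      proof (rule runs_For[where I = ?J])
        show "ival (Reg 3) s2 = m"
          using r1 s2(1) by (simp add: agree_def)
        show "?J 0 s2"
          by simp
        fix i s' assume i: "i < m" and J: "?J i s'"
        then have c: "cell s' 14 i 0 = residual m F i i"
          using s2 by (simp add: agree_def)
        show "runs (IfZero (Cell 14 (Reg 5) (Const 0)) Skip (SetReg 6 (Reg 5))) (set_reg 5 i s')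
            (1 + ops (Cell 14 (Reg 5) (Const 0)) + 1) (?J (Suc i))"
        proof (rule runs_IfZero)
          assume "sval rt (Cell 14 (Reg 5) (Const 0)) (set_reg 5 i s') = 0"
          then have "?J (Suc i) (set_reg 5 i s')"
            using J c by (auto simp: less_Suc_eq)
          then show "runs Skip (set_reg 5 i s') 1 (?J (Suc i))"
            by (intro runs_mono[OF runs_Skip]) auto
        next
          assume "sval rt (Cell 14 (Reg 5) (Const 0)) (set_reg 5 i s') \<noteq> 0"
          then show "runs (SetReg 6 (Reg 5)) (set_reg 5 i s') 1 (?J (Suc i))"
            using J c i by (intro runs_SetReg) auto
        qed
      qed
      \<comment> \<open>Column \<open>j\<close> of \<open>F\<close> is still zero, so the search
        succeeds.\<close>
      moreover have "\<exists>i<m. residual m F i i \<noteq> 0"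
        using residual_nonzero[of F m "\<lambda>l. d l \<noteq> 0 \<or> l < j" j] s1 j by auto
      moreover have "m * (1 + ops (Cell 14 (Reg 5) (Const 0)) + 1 + 1) \<le> 3 * (m * m)"
        by (cases m) auto
      ultimately show ?thesis
        by (elim runs_mono) auto
    qed
    have P34: "runs (Seq P3 P4) s3 (12 * (m * m) + 8 * (m * m)) (?I (Suc j))"
      if s3: "agree {14} {5, 6, 10, 11, 12} s1 s3" "\<forall>i<m. cell s3 14 i 0 = residual m F i i"
        and p: "reg s3 6 = p" "p < m" "residual m F p p \<noteq> 0" for s3 p
    proof (rule runs_Seq)
      let ?c = "\<lambda>i. residual m F i p / rt (residual m F p p)"
      have r3: "reg s3 3 = m" "stores 13 F s3" "stores 9 (1\<^sub>m m) s3"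
        using r1 s1(1,3) s(2) s3(1) by (simp_all add: agree_def stores_def)
      have "runs P3 s3 ((ops (Cell 9 (Reg 10) (Reg 6)) + ops (Sub Zero (Mul (Cell 13 (Reg 10) (Reg 12))
          (Conj (Cell 13 (Reg 6) (Reg 12))))) + ops (Sqrt (Cell 14 (Reg 6) (Const 0))) + 8) * (m * m))
        (\<lambda>s'. agree {15} {10, 11, 12} s3 s' \<and> stores 15 (mat m 1 (\<lambda>(i, j). ?c i)) s')"
        unfolding P3_def
        using r3 s3(2) dF mm p
        by (intro runs_fill_mat[where ev = "\<lambda>i j. cell s3 9 i p" and nr = m
              and fv = "\<lambda>_ _. rt (cell s3 14 p 0)"
              and tv = "\<lambda>i j l. 0 - cell s3 13 i l * conjugate (cell s3 13 p l)"])
          (auto simp: agree_def storesD residual_def sum_negf)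
      then show "runs P3 s3 (12 * (m * m))
        (\<lambda>s'. agree {15} {10, 11, 12} s3 s' \<and> (\<forall>i<m. cell s' 15 i 0 = ?c i))"
        by (rule runs_mono) (auto simp: stores_def)
    next
      let ?c = "\<lambda>i. residual m F i p / rt (residual m F p p)"
      fix s4 assume s4: "agree {15} {10, 11, 12} s3 s4 \<and> (\<forall>i<m. cell s4 15 i 0 = ?c i)"
      let ?G = "fill_column m F j p"
      have r4: "reg s4 3 = m" "reg s4 4 = j"
        using r1 s1(2) s3(1) s4 by (simp_all add: agree_def)
      have "runs P4 s4 ((ops (Cell 15 (Reg 10) (Reg 11)) + ops Zero + ops One + 8) * (m * m))
        (\<lambda>s'. agree {13} {10, 11, 12} s4 s' \<and> cell s' 13 = (\<lambda>i l. if i < m \<and> j \<le> l \<and> l < j + 1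
          then (cell s4 15 i (l - j) + (\<Sum>l<(0 :: nat). 0)) / 1 else cell s4 13 i l))"
        unfolding P4_def
        using r4 mm
        by (intro runs_fill[where ev = "cell s4 15" and tv = "\<lambda>_ _ _. 0" and fv = "\<lambda>_ _. 1"])
          (auto simp: agree_def)
      moreover have "?I (Suc j) s'" if s': "agree {13} {10, 11, 12} s4 s'"
          "cell s' 13 = (\<lambda>i l. if i < m \<and> j \<le> l \<and> l < j + 1
          then (cell s4 15 i (l - j) + (\<Sum>l<(0 :: nat). 0)) / 1 else cell s4 13 i l)" for s'
      proof -
        have 1: "?ag s'"
          using s1(1) s3(1) s4 s'(1) by (auto simp: agree_def)
        have "stores 13 F s4"
          using s1(3) s3(1) s4 by (auto simp: agree_def stores_def)
        then have 2: "stores 13 ?G s'"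
          using s4 s'(2) dF by (auto simp: stores_def fill_column_def)
        have "?G\<^sup>H * ?G = mat_diag m (\<lambda>l. if (d l \<noteq> 0 \<or> l < j) \<or> l = j then 1 else 0)"
          using s1(4) j p by (intro fill_column_gram) auto
        also have "\<dots> = mat_diag m (\<lambda>l. if d l \<noteq> 0 \<or> l < Suc j then 1 else 0)"
          by (intro mat_diag_cong) auto
        finally have "?inv (Suc j) ?G"
          using s1(4) j by (auto simp: fill_column_def)
        with 1 2 show ?thesis
          by blast
      qed
      ultimately show "runs P4 s4 (8 * (m * m)) (?I (Suc j))"
        by (elim runs_mono) auto
    qed
    have "runs (Seq P1 (Seq P2 (Seq P3 P4))) s1
        (11 * (m * m) + (3 * (m * m) + (12 * (m * m) + 8 * (m * m)))) (?I (Suc j))"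
    proof (rule runs_Seq[OF P1], rule runs_Seq, rule P2)
      fix s2 s3
      assume s2: "agree {14} {10, 11, 12} s1 s2 \<and> (\<forall>i<m. cell s2 14 i 0 = residual m F i i)"
        and s3: "agree {} {5, 6} s2 s3 \<and> reg s3 6 < m \<and> residual m F (reg s3 6) (reg s3 6) \<noteq> 0"
      then show "runs (Seq P3 P4) s3 (12 * (m * m) + 8 * (m * m)) (?I (Suc j))"
        by (intro P34[of _ "reg s3 6"]) (auto simp: agree_def)
    qed auto
    then show ?thesis
      by (rule runs_mono) auto
  qed
  have "runs complete_unitary s (m * (34 * (m * m) + ops (Cell 12 (Reg 4) (Const 0)) + 1 + 1)) (?I m)"
    unfolding complete_unitary_def P1_def[symmetric] P2_def[symmetric] P3_def[symmetric]
      P4_def[symmetric]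
  proof (rule runs_For[where I = ?I])
    show "ival (Reg 3) s = m"
      using s by simp
    have "E\<^sup>H * E = mat_diag m (\<lambda>l. if d l \<noteq> 0 \<or> l < 0 then 1 else 0)"
      unfolding E(2) by (intro mat_diag_cong) auto
    then show "?I 0 s"
      using E s by auto
    fix j s' assume j: "j < m" and I: "?I j s'"
    then obtain F where F: "stores 13 F s'" "?inv j F"
      by auto
    have dj: "cell s' 12 j 0 = d j"
      using I s j by (simp add: agree_def)
    show "runs (IfZero (Cell 12 (Reg 4) (Const 0)) (Seq P1 (Seq P2 (Seq P3 P4))) Skip) (set_reg 4 j s')
        (34 * (m * m) + ops (Cell 12 (Reg 4) (Const 0)) + 1) (?I (Suc j))"
    proof (rule runs_IfZero)
      assume "sval rt (Cell 12 (Reg 4) (Const 0)) (set_reg 4 j s') = 0"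
      then show "runs (Seq P1 (Seq P2 (Seq P3 P4))) (set_reg 4 j s') (34 * (m * m)) (?I (Suc j))"
        using I F dj j by (intro step[where F = F]) (auto simp: stores_def)
    next
      assume "sval rt (Cell 12 (Reg 4) (Const 0)) (set_reg 4 j s') \<noteq> 0"
      then have "d j \<noteq> 0"
        using dj by simp
      then have "mat_diag m (\<lambda>l. if d l \<noteq> 0 \<or> l < j then 1 else 0 :: 'a) =
          mat_diag m (\<lambda>l. if d l \<noteq> 0 \<or> l < Suc j then 1 else 0)"
        by (intro mat_diag_cong) (auto simp: less_Suc_eq)
      then have "?I (Suc j) (set_reg 4 j s')"
        using I by (auto simp: stores_def)
      then show "runs Skip (set_reg 4 j s') (34 * (m * m)) (?I (Suc j))"
        by (intro runs_mono[OF runs_Skip]) auto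
    qed
  qed
  then show ?thesis
  proof (rule runs_mono)
    have "m \<le> m * m * m"
      by (cases m) auto
    moreover have "m * (34 * (m * m) + ops (Cell 12 (Reg 4) (Const 0)) + 1 + 1) =
        34 * (m * m * m) + 2 * m"
      by (simp add: algebra_simps)
    ultimately show "m * (34 * (m * m) + ops (Cell 12 (Reg 4) (Const 0)) + 1 + 1) \<le> 36 * B"
      using B by linarith
  next
    fix s' assume "?I m s'"
    then obtain F where F: "?ag s'" "stores 13 F s'" "?inv m F"
      by auto
    then have "F\<^sup>H * F = 1\<^sub>m m"
      by (auto intro!: mat_diag_cong simp flip: mat_diag_one)
    then have "F \<in> unitary_matrices m"
      using F by (auto simp: unitary_matrices_def)
    with F show "?ag s' \<and> (\<exists>F \<in> unitary_matrices m. stores 13 F s' \<and>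
        (\<forall>i<m. \<forall>l<m. d l \<noteq> 0 \<longrightarrow> F $$ (i, l) = E $$ (i, l)))"
      by blast
  qed
qed

end

section \<open>The algorithm\<close>

text \<open>Array 9 holds the identity, 3 holds \<open>Y\<close>, 4 its Gram matrix, 5 and 6 the eigendecomposition
  \<open>(Q, d)\<close>, 7 holds \<open>W\<close>, 8 holds \<open>M\<close>, 10 to 13 play for \<open>M\<close> the roles of 4 to 7, 16 holds \<open>P - 1\<close>,
  17 and 18 hold \<open>U W\<close> and \<open>U W (P - 1)\<close>. The result is collected in 19 because \<open>U\<close> is still
  being read.\<close>

definition closest_unitary :: com where
  "closest_unitary =
    For 2 (Minus (Const 1) (Minus (Const 1) (Reg 1)))
      (Seq (SetReg 3 (Plus (Reg 1) (Reg 1)))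
      (Seq (For 5 (Reg 3) (SetCell 9 (Reg 5) (Reg 5) One))
      (Seq (fill 3 (Const 0) (Reg 0) (Reg 1) (Reg 0) Zero
        (Mul (Conj (Cell 0 (Reg 12) (Reg 10))) (Cell 1 (Reg 12) (Reg 11))) One)
      (Seq (fill 3 (Reg 1) (Reg 0) (Reg 1) (Const 0) (Cell 2 (Reg 10) (Reg 11)) Zero One)
      (Seq (svd 0 3 4 5 6 7)
      (Seq (fill 8 (Const 0) (Reg 3) (Reg 3) (Reg 1) (Cell 9 (Reg 10) (Reg 11))
        (Mul (Mul (Sqrt (Cell 6 (Reg 10) (Const 0))) (Conj (Cell 5 (Reg 12) (Reg 10))))
          (Conj (Mul (Sqrt (Cell 6 (Reg 11) (Const 0)))
            (Conj (Cell 5 (Plus (Reg 1) (Reg 12)) (Reg 11)))))) One)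
      (Seq (svd 3 8 10 11 12 13)
      (Seq complete_unitary
      (Seq (fill 16 (Const 0) (Reg 3) (Reg 3) (Reg 3) (Sub Zero (Cell 9 (Reg 10) (Reg 11)))
        (Mul (Cell 13 (Reg 10) (Reg 12)) (Conj (Cell 11 (Reg 11) (Reg 12)))) One)
      (Seq (fill 17 (Const 0) (Reg 0) (Reg 3) (Reg 0) Zero
        (Mul (Cell 0 (Reg 10) (Reg 12)) (Cell 7 (Reg 12) (Reg 11))) One)
      (Seq (fill 18 (Const 0) (Reg 0) (Reg 3) (Reg 3) Zero
        (Mul (Cell 17 (Reg 10) (Reg 12)) (Cell 16 (Reg 12) (Reg 11))) One)
      (Seq (fill 19 (Const 0) (Reg 0) (Reg 0) (Reg 3) (Cell 0 (Reg 10) (Reg 11))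
        (Mul (Cell 18 (Reg 10) (Reg 12)) (Conj (Cell 7 (Reg 11) (Reg 12)))) One)
      (fill 0 (Const 0) (Reg 0) (Reg 0) (Const 0) (Cell 19 (Reg 10) (Reg 11)) Zero One)))))))))))))"

context machine
begin

lemma eigE:
  assumes "A\<^sup>H = A" "A \<in> carrier_mat m m"
  obtains Q d where "eig A = (Q, d)" "Q \<in> unitary_matrices m"
    "A = Q * mat_diag m (\<lambda>j. d $ j) * Q\<^sup>H"
  using eig assms unfolding eigendecomposer_def by metis

lemma runs_closest_unitary:
  fixes U :: "'a mat"
  assumes U: "U \<in> unitary_matrices n" and k: "k > 0"
  shows "runs closest_unitary (input_state n k U a b) (1304 * (k * (n\<^sup>2 + n * k + k\<^sup>2)))
    (\<lambda>s. is_arg_min (\<lambda>V. (frobenius_norm (U + outer_sum n k a b - V))\<^sup>2)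
      (\<lambda>V. V \<in> unitary_matrices n) (output_matrix n s))"
proof -
  note dU = unitary_matricesD[OF U]
  define m where "m = k + k"
  \<comment> \<open>The 8 comes from \<open>m = k + k\<close>, as m^3 = 8 k^3. Thus \<open>B\<close>
    bounds the number of iterations of every loop nest; \<open>k > 0\<close> is what lets it absorb
    terms such as n^2, the cost of copying the output.\<close>
  define B where "B = 8 * (k * (n\<^sup>2 + n * k + k\<^sup>2))"
  have B: "1 \<le> B" "n \<le> B" "m \<le> B" "n * k \<le> B" "n * m \<le> B" "m * m \<le> B" "n * n \<le> B"
    "n * k * n \<le> B" "n * m * m \<le> B" "n * m * n \<le> B" "m * m * k \<le> B" "m * m * m \<le> B" "n * n * m \<le> B"
  proof -
    have "n * k \<le> n * k * k" "n * n \<le> n * n * k" "k \<le> k * k" "k * k \<le> k * k * k" "n \<le> n * n"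
      using k by auto
    moreover have "B = 8 * (n * n * k) + 8 * (n * k * k) + 8 * (k * k * k)"
      by (simp add: B_def power2_eq_square algebra_simps)
    moreover have "n * k * n = n * n * k" "n * m = 2 * (n * k)" "m * m = 4 * (k * k)"
      "n * m * m = 4 * (n * k * k)" "n * m * n = 2 * (n * n * k)" "m * m * k = 4 * (k * k * k)"
      "m * m * m = 8 * (k * k * k)" "n * n * m = 2 * (n * n * k)" "m = 2 * k"
      by (simp_all add: m_def algebra_simps)
    ultimately show "1 \<le> B" "n \<le> B" "m \<le> B" "n * k \<le> B" "n * m \<le> B" "m * m \<le> B" "n * n \<le> B"
      "n * k * n \<le> B" "n * m * m \<le> B" "n * m * n \<le> B" "m * m * k \<le> B" "m * m * m \<le> B"
      "n * n * m \<le> B"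
      using k by linarith+
  qed
  define Xa where "Xa = mat n k (\<lambda>(i, j). a j $ i)"
  define Xb where "Xb = mat n k (\<lambda>(i, j). b j $ i)"
  define Y where "Y = mat n m (\<lambda>(i, j). if j < k then (U\<^sup>H * Xa) $$ (i, j) else Xb $$ (i, j - k))"
  have dX: "dim_row Xa = n" "dim_col Xa = k" "dim_row Xb = n" "dim_col Xb = k"
    and dY: "dim_row Y = n" "dim_col Y = m"
    by (auto simp: Xa_def Xb_def Y_def)
  obtain Q d where eigY: "eig (Y\<^sup>H * Y) = (Q, d)" and Q: "Q \<in> unitary_matrices m"
    and QY: "Y\<^sup>H * Y = Q * mat_diag m (\<lambda>j. d $ j) * Q\<^sup>H"
    by (rule eigE[of "Y\<^sup>H * Y" m]) (auto simp: mat_adjoint_mult dY)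
  note dQ = unitary_matricesD[OF Q]
  define W where "W = normalized_product Y Q (\<lambda>j. d $ j)"
  note svdY = normalized_product_svd[OF Q dY(2) QY, folded W_def]
  have dW: "dim_row W = n" "dim_col W = m"
    by (simp_all add: W_def normalized_product_def dY dQ)
  \<comment> \<open>The decomposition of \<open>Y\<close> expresses its columns in terms of those of
    \<open>W\<close>. \<open>X\<close> and \<open>X'\<close> are the first and the last
    \<open>k\<close> columns of the coefficient matrix S Q^H, so that
    \<open>W * X = U\<^sup>H * Xa\<close> and \<open>W * X' = Xb\<close>. Their rows at zero
    singular values vanish.\<close>
  define X where "X = mat m k (\<lambda>(i, l). rt (d $ i) * conjugate (Q $$ (l, i)))"
  define X' where "X' = mat m k (\<lambda>(i, l). rt (d $ i) * conjugate (Q $$ (k + l, i)))"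
  have dXX: "dim_row X = m" "dim_col X = k" "dim_row X' = m" "dim_col X' = k"
    by (auto simp: X_def X'_def)
  define M where "M = 1\<^sub>m m + X * X'\<^sup>H"
  have dM: "dim_row M = m" "dim_col M = m"
    by (auto simp: M_def dXX)
  have M_index: "M $$ (i, j) = 1\<^sub>m m $$ (i, j) + (\<Sum>l<k. rt (d $ i) * conjugate (Q $$ (l, i)) *
      conjugate (rt (d $ j) * conjugate (Q $$ (k + l, j))))" if "i < m" "j < m" for i j
  proof -
    have "M $$ (i, j) = 1\<^sub>m m $$ (i, j) + (\<Sum>l<k. X $$ (i, l) * conjugate (X' $$ (j, l)))"
      using that dXX by (simp add: M_def mult_mat_index del: index_mult_mat(1) index_one_mat(1))
    then show ?thesis
      using that by (simp add: X_def X'_def)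
  qed
  obtain Q2 d2 where eigM: "eig (M\<^sup>H * M) = (Q2, d2)" and Q2: "Q2 \<in> unitary_matrices m"
    and QM: "M\<^sup>H * M = Q2 * mat_diag m (\<lambda>j. d2 $ j) * Q2\<^sup>H"
    by (rule eigE[of "M\<^sup>H * M" m]) (auto simp: mat_adjoint_mult dM)
  note dQ2 = unitary_matricesD[OF Q2]
  define E where "E = normalized_product M Q2 (\<lambda>j. d2 $ j)"
  note svdM = normalized_product_svd[OF Q2 dM(2) QM, folded E_def]
  have dE: "dim_row E = m" "dim_col E = m"
    by (simp_all add: E_def normalized_product_def dM dQ2)
  have rt0: "rt 0 = 0"
    using rt_of_real[of 0] by simp
  have Y_index: "Y $$ (i, j) = (\<Sum>r<m. W $$ (i, r) * (rt (d $ r) * conjugate (Q $$ (j, r))))"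
    if "i < n" "j < m" for i j
  proof -
    have "Y $$ (i, j) = (W * (mat_diag m (\<lambda>j. rt (d $ j)) * Q\<^sup>H)) $$ (i, j)"
      using svdY(3) dW dQ by (simp add: mult_mat_assoc)
    then show ?thesis
      using that dW dQ
      by (simp add: mult_mat_index[of _ W] mat_diag_mult_index del: index_mult_mat(1))
  qed
  have WX: "W * X = U\<^sup>H * Xa"
  proof (rule eq_matI)
    fix i j assume "i < dim_row (U\<^sup>H * Xa)" "j < dim_col (U\<^sup>H * Xa)"
    then have "i < n" "j < k" "j < m"
      using dU dX by (auto simp: m_def)
    then show "(W * X) $$ (i, j) = (U\<^sup>H * Xa) $$ (i, j)"
      using Y_index[of i j] dW dXX by (simp add: mult_mat_index X_def Y_def del: index_mult_mat(1))
  qed (use dU dX dW dXX in auto)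
  have WX': "W * X' = Xb"
  proof (rule eq_matI)
    fix i j assume "i < dim_row Xb" "j < dim_col Xb"
    then have "i < n" "j < k" "k + j < m"
      using dX by (auto simp: m_def)
    then show "(W * X') $$ (i, j) = Xb $$ (i, j)"
      using Y_index[of i "k + j"] dW dXX
      by (simp add: mult_mat_index X'_def Y_def del: index_mult_mat(1))
  qed (use dX dW dXX in auto)
  have "outer_sum n k a b = Xa * Xb\<^sup>H"
    by (rule eq_matI)
      (auto simp: outer_sum_def mult_mat_index dX Xa_def Xb_def simp del: index_mult_mat(1))
  also have "\<dots> = U * (U\<^sup>H * Xa) * Xb\<^sup>H"
    using dU dX by (simp add: unitary_cancel[OF U])
  also have "\<dots> = U * (W * (X * X'\<^sup>H) * W\<^sup>H)"
    using dU dW dXX by (simp add: mat_adjoint_mult mult_mat_assoc flip: WX WX')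
  finally have G: "outer_sum n k a b = U * (W * (X * X'\<^sup>H) * W\<^sup>H)" .
  have closest: "is_arg_min (\<lambda>V. (frobenius_norm (U + outer_sum n k a b - V))\<^sup>2)
      (\<lambda>V. V \<in> unitary_matrices n) (U + U * W * (F * Q2\<^sup>H - 1\<^sub>m m) * W\<^sup>H)"
    if F: "F \<in> unitary_matrices m" "\<forall>i<m. \<forall>l<m. d2 $ l \<noteq> 0 \<longrightarrow> F $$ (i, l) = E $$ (i, l)" for F
    unfolding G
  proof (rule closest_unitary_of_compression[OF U _ _ _ _ _ _ M_def Q2 QM svdM(1) F(1)])
    show "W\<^sup>H * W = mat_diag m (\<lambda>j. if d $ j = 0 then 0 else 1)"
      by (rule svdY(2))
    \<comment> \<open>The completion changes only columns with \<open>d2 $ j = 0\<close>, which the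
      factor \<open>rt 0 = 0\<close> removes.\<close>
    have "E $$ (i, j) * rt (d2 $ j) = F $$ (i, j) * rt (d2 $ j)" if "i < m" "j < m" for i j
      using F(2) rt0 that by (cases "d2 $ j = 0") auto
    then have "E * mat_diag m (\<lambda>j. rt (d2 $ j)) = F * mat_diag m (\<lambda>j. rt (d2 $ j))"
      using unitary_matricesD[OF F(1)] dE
      by (intro eq_matI) (simp_all add: mult_mat_diag_index del: index_mult_mat(1))
    then show "M = F * mat_diag m (\<lambda>j. rt (d2 $ j)) * Q2\<^sup>H"
      using svdM(3) by simp
  qed (use dW dXX rt0 in \<open>auto simp: X_def X'_def\<close>)

  \<comment> \<open>The assertions between the phases, each retaining only what is still read. From
    \<open>?I8\<close> on they depend on the completion \<open>F\<close>, of which only the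
    properties \<open>?F\<close> are known.\<close>
  let ?base = "\<lambda>s. reg s 0 = n \<and> reg s 1 = k \<and> reg s 3 = m \<and> stores 0 U s"
  let ?I1 = "\<lambda>s. ?base s \<and> stores 1 Xa s \<and> stores 2 Xb s \<and> cell s 9 = (\<lambda>_ _. 0)"
  let ?I2 = "\<lambda>s. ?base s \<and> stores 1 Xa s \<and> stores 2 Xb s \<and> stores 9 (1\<^sub>m m) s"
  let ?I3 = "\<lambda>s. ?base s \<and> stores 3 (U\<^sup>H * Xa) s \<and> stores 2 Xb s \<and> stores 9 (1\<^sub>m m) s"
  let ?I4 = "\<lambda>s. ?base s \<and> stores 3 Y s \<and> stores 9 (1\<^sub>m m) s"
  let ?I5 = "\<lambda>s. ?base s \<and> stores 9 (1\<^sub>m m) s \<and> stores 7 W s \<and> stores 5 Q s \<and>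
    (\<forall>j<m. cell s 6 j 0 = d $ j)"
  let ?I6 = "\<lambda>s. ?base s \<and> stores 9 (1\<^sub>m m) s \<and> stores 7 W s \<and> stores 8 M s"
  let ?I7 = "\<lambda>s. ?base s \<and> stores 9 (1\<^sub>m m) s \<and> stores 7 W s \<and> stores 11 Q2 s \<and>
    (\<forall>j<m. cell s 12 j 0 = d2 $ j) \<and> stores 13 E s"
  let ?F = "\<lambda>F. F \<in> unitary_matrices m \<and> (\<forall>i<m. \<forall>l<m. d2 $ l \<noteq> 0 \<longrightarrow> F $$ (i, l) = E $$ (i, l))"
  let ?P = "\<lambda>F. F * Q2\<^sup>H - 1\<^sub>m m"
  let ?I8 = "\<lambda>F s. ?base s \<and> stores 9 (1\<^sub>m m) s \<and> stores 7 W s \<and> stores 11 Q2 s \<and> stores 13 F s"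
  let ?I9 = "\<lambda>F s. ?base s \<and> stores 7 W s \<and> stores 16 (?P F) s"
  let ?I10 = "\<lambda>F s. ?base s \<and> stores 7 W s \<and> stores 16 (?P F) s \<and> stores 17 (U * W) s"
  let ?I11 = "\<lambda>F s. ?base s \<and> stores 7 W s \<and> stores 18 (U * W * ?P F) s"
  let ?V = "\<lambda>F. U + U * W * ?P F * W\<^sup>H"
  let ?I12 = "\<lambda>F s. ?base s \<and> stores 19 (?V F) s"

  have phase0: "runs (SetReg 3 (Plus (Reg 1) (Reg 1))) (set_reg 2 0 (input_state n k U a b)) 1 ?I1"
    using dU by (intro runs_SetReg) (auto simp: input_state_def stores_def Xa_def Xb_def m_def)
  \<comment> \<open>Array 9 starts out as zero, so writing the diagonal is enough.\<close>
  have phase1: "runs (For 5 (Reg 3) (SetCell 9 (Reg 5) (Reg 5) One)) s (2 * B) ?I2" if s: "?I1 s" for s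
  proof -
    let ?I = "\<lambda>i s'. agree {9} {5} s s' \<and> cell s' 9 = (\<lambda>r c. if r = c \<and> r < i then 1 else 0)"
    have "runs (For 5 (Reg 3) (SetCell 9 (Reg 5) (Reg 5) One)) s (m * (ops One + 1 + 1)) (?I m)"
    proof (rule runs_For[where I = ?I])
      fix i s' assume "?I i s'"
      then show "runs (SetCell 9 (Reg 5) (Reg 5) One) (set_reg 5 i s') (ops One + 1) (?I (Suc i))"
        by (intro runs_SetCell) (auto simp: fun_eq_iff less_Suc_eq)
    qed (use s in auto)
    then show ?thesis
    proof (rule runs_mono)
      show "m * (ops One + 1 + 1) \<le> 2 * B"
        using B(3) by simp
      fix s' assume "?I m s'"
      then show "?I2 s'"
        using s by (simp add: agree_def stores_def)
    qed
  qed
  have phase2: "runs (fill 3 (Const 0) (Reg 0) (Reg 1) (Reg 0) Zero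
        (Mul (Conj (Cell 0 (Reg 12) (Reg 10))) (Cell 1 (Reg 12) (Reg 11))) One) s (10 * B) ?I3"
    if s: "?I2 s" for s
    apply (rule runs_mono, rule runs_fill_mat[where M = "U\<^sup>H * Xa" and np = n and nq = k and nr = n
            and ev = "\<lambda>_ _. 0" and tv = "\<lambda>i j l. conjugate (cell s 0 l i) * cell s 1 l j"
            and fv = "\<lambda>_ _. 1" and B = B])
    subgoal using s by (simp add: agree_def)
    subgoal using s by (simp add: agree_def)
    subgoal by (rule B)
    subgoal by (rule B)
    subgoal by (rule B)
    subgoal using dU dX by simp
    subgoal using dU dX by simp
    subgoal using s dU dX by (simp add: stores_def mult_mat_index del: index_mult_mat(1))
    subgoal by simp
    subgoal using s by (simp add: agree_def stores_def)
    done
  \<comment> \<open>The column offset \<open>k\<close> places \<open>Xb\<close> next to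
    \<open>U\<^sup>H * Xa\<close>, which completes \<open>Y\<close>.\<close>
  have phase3: "runs (fill 3 (Reg 1) (Reg 0) (Reg 1) (Const 0) (Cell 2 (Reg 10) (Reg 11)) Zero One)
      s (8 * B) ?I4"
    if s: "?I3 s" for s
    apply (rule runs_mono, rule runs_fill[where no = k and np = n and nq = k and nr = 0
            and ev = "cell s 2" and tv = "\<lambda>_ _ _. 0" and fv = "\<lambda>_ _. 1" and B = B])
    subgoal using s by (simp add: agree_def)
    subgoal using s by (simp add: agree_def)
    subgoal by (rule B)
    subgoal by (rule B)
    subgoal by simp
    subgoal by simp
    subgoal using s dU dX by (auto simp: agree_def stores_def Y_def m_def simp del: index_mult_mat(1))
    done
  have phase4: "runs (svd 0 3 4 5 6 7) s (21 * B) ?I5" if s: "?I4 s" for s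
    apply (rule runs_mono, rule runs_svd[where A = Y and np = n and m = m and V = Q and d = d and B = B])
    subgoal using s by simp
    subgoal by (rule dY(1))
    subgoal by (rule dY(2))
    subgoal by (rule eigY)
    subgoal by (rule dQ(1))
    subgoal by (rule dQ(2))
    subgoal using s by simp
    subgoal using s by simp
    subgoal by simp
    subgoal by simp
    subgoal by (rule B)
    subgoal by (rule B)
    subgoal by (rule B)
    subgoal by (rule B)
    subgoal by (rule B)
    subgoal by (rule B)
    subgoal by simp
    subgoal using s by (simp add: agree_def stores_def W_def)
    done
  have phase5: "runs (fill 8 (Const 0) (Reg 3) (Reg 3) (Reg 1) (Cell 9 (Reg 10) (Reg 11))
        (Mul (Mul (Sqrt (Cell 6 (Reg 10) (Const 0))) (Conj (Cell 5 (Reg 12) (Reg 10))))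
          (Conj (Mul (Sqrt (Cell 6 (Reg 11) (Const 0)))
            (Conj (Cell 5 (Plus (Reg 1) (Reg 12)) (Reg 11)))))) One) s (16 * B) ?I6"
    if s: "?I5 s" for s
    apply (rule runs_mono, rule runs_fill_mat[where M = M and np = m and nq = m and nr = k
            and ev = "cell s 9" and tv = "\<lambda>i j l. rt (cell s 6 i 0) * conjugate (cell s 5 l i) *
              conjugate (rt (cell s 6 j 0) * conjugate (cell s 5 (k + l) j))"
            and fv = "\<lambda>_ _. 1" and B = B])
    subgoal using s by (simp add: agree_def)
    subgoal using s by (simp add: agree_def)
    subgoal by (rule B)
    subgoal by (rule B)
    subgoal by (rule B)
    subgoal by (rule dM)
    subgoal by (rule dM)
    subgoal using s dQ by (simp add: stores_def M_index m_def)
    subgoal by simp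
    subgoal using s by (simp add: agree_def stores_def)
    done
  have phase6: "runs (svd 3 8 10 11 12 13) s (21 * B) ?I7" if s: "?I6 s" for s
    apply (rule runs_mono, rule runs_svd[where A = M and np = m and m = m and V = Q2 and d = d2 and B = B])
    subgoal using s by simp
    subgoal by (rule dM(1))
    subgoal by (rule dM(2))
    subgoal by (rule eigM)
    subgoal by (rule dQ2(1))
    subgoal by (rule dQ2(2))
    subgoal using s by simp
    subgoal using s by simp
    subgoal by simp
    subgoal by simp
    subgoal by (rule B)
    subgoal by (rule B)
    subgoal by (rule B)
    subgoal by (rule B)
    subgoal by (rule B)
    subgoal by (rule B)
    subgoal by simp
    subgoal using s by (simp add: agree_def stores_def E_def)
    done
  have phase7: "runs complete_unitary s (36 * B) (\<lambda>s'. \<exists>F. ?F F \<and> ?I8 F s')" if s: "?I7 s" for s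
    apply (rule runs_mono, rule runs_complete_unitary[where E = E and m = m and d = "\<lambda>j. d2 $ j" and B = B])
    subgoal using dE by auto
    subgoal by (rule svdM(2))
    subgoal using s by simp
    subgoal using s by simp
    subgoal using s by simp
    subgoal using s by simp
    subgoal by (rule B)
    subgoal by simp
    subgoal using s by (auto simp: agree_def stores_def)
    done
  have phase8: "runs (fill 16 (Const 0) (Reg 3) (Reg 3) (Reg 3) (Sub Zero (Cell 9 (Reg 10) (Reg 11)))
        (Mul (Cell 13 (Reg 10) (Reg 12)) (Conj (Cell 11 (Reg 11) (Reg 12)))) One) s (11 * B) (?I9 F)"
    if s: "?F F" "?I8 F s" for F s
  proof -
    note dF = unitary_matricesD[OF conjunct1[OF s(1)]]
    show ?thesis
      apply (rule runs_mono, rule runs_fill_mat[where M = "?P F" and np = m and nq = m and nr = m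
            and ev = "\<lambda>i j. 0 - cell s 9 i j"
            and tv = "\<lambda>i j l. cell s 13 i l * conjugate (cell s 11 j l)"
            and fv = "\<lambda>_ _. 1" and B = B])
    subgoal using s(2) by (simp add: agree_def)
    subgoal using s(2) by (simp add: agree_def)
    subgoal by (rule B)
    subgoal by (rule B)
    subgoal by (rule B)
    subgoal using dF dQ2 by simp
    subgoal using dF dQ2 by simp
    subgoal using s(2) dF dQ2 by (simp add: stores_def mult_mat_index[of _ F] del: index_mult_mat(1))
    subgoal by simp
    subgoal using s(2) by (simp add: agree_def stores_def)
    done
  qed
  have phase9: "runs (fill 17 (Const 0) (Reg 0) (Reg 3) (Reg 0) Zero
        (Mul (Cell 0 (Reg 10) (Reg 12)) (Cell 7 (Reg 12) (Reg 11))) One) s (9 * B) (?I10 F)"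
    if s: "?I9 F s" for F s
    apply (rule runs_mono, rule runs_fill_mat[where M = "U * W" and np = n and nq = m and nr = n
            and ev = "\<lambda>_ _. 0" and tv = "\<lambda>i j l. cell s 0 i l * cell s 7 l j"
            and fv = "\<lambda>_ _. 1" and B = B])
    subgoal using s by (simp add: agree_def)
    subgoal using s by (simp add: agree_def)
    subgoal by (rule B)
    subgoal by (rule B)
    subgoal by (rule B)
    subgoal using dU dW by simp
    subgoal using dU dW by simp
    subgoal using s dU dW by (simp add: stores_def mult_mat_index[of _ U] del: index_mult_mat(1))
    subgoal by simp
    subgoal using s by (simp add: agree_def stores_def)
    done
  have phase10: "runs (fill 18 (Const 0) (Reg 0) (Reg 3) (Reg 3) Zero
        (Mul (Cell 17 (Reg 10) (Reg 12)) (Cell 16 (Reg 12) (Reg 11))) One) s (9 * B) (?I11 F)"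
    if s: "?I10 F s" "?F F" for F s
    apply (rule runs_mono, rule runs_fill_mat[where M = "U * W * ?P F" and np = n and nq = m and nr = m
            and ev = "\<lambda>_ _. 0" and tv = "\<lambda>i j l. cell s 17 i l * cell s 16 l j"
            and fv = "\<lambda>_ _. 1" and B = B])
    subgoal using s(1) by (simp add: agree_def)
    subgoal using s(1) by (simp add: agree_def)
    subgoal by (rule B)
    subgoal by (rule B)
    subgoal by (rule B)
    subgoal using dU dW dQ2 by simp
    subgoal using dU dW dQ2 by simp
    subgoal using s(1) dU dW dQ2 by (simp add: stores_def mult_mat_index[of _ "U * W"] del: index_mult_mat(1))
    subgoal by simp
    subgoal using s(1) by (simp add: agree_def stores_def)
    done
  have phase11: "runs (fill 19 (Const 0) (Reg 0) (Reg 0) (Reg 3) (Cell 0 (Reg 10) (Reg 11))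
        (Mul (Cell 18 (Reg 10) (Reg 12)) (Conj (Cell 7 (Reg 11) (Reg 12)))) One) s (10 * B) (?I12 F)"
    if s: "?I11 F s" for F s
    apply (rule runs_mono, rule runs_fill_mat[where M = "?V F" and np = n and nq = n and nr = m
            and ev = "cell s 0" and tv = "\<lambda>i j l. cell s 18 i l * conjugate (cell s 7 j l)"
            and fv = "\<lambda>_ _. 1" and B = B])
    subgoal using s by (simp add: agree_def)
    subgoal using s by (simp add: agree_def)
    subgoal by (rule B)
    subgoal by (rule B)
    subgoal by (rule B)
    subgoal using dU dW dQ2 by simp
    subgoal using dU dW dQ2 by simp
    subgoal using s dU dW dQ2 by (simp add: stores_def mult_mat_index[of _ "U * W * ?P F"] del: index_mult_mat(1))
    subgoal by simp
    subgoal using s by (simp add: agree_def stores_def)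
    done
  have phase12: "runs (fill 0 (Const 0) (Reg 0) (Reg 0) (Const 0) (Cell 19 (Reg 10) (Reg 11)) Zero One)
      s (8 * B) (\<lambda>s'. output_matrix n s' = ?V F)" if s: "?I12 F s" for F s
    apply (rule runs_mono, rule runs_fill_mat[where M = "?V F" and np = n and nq = n and nr = 0
            and ev = "cell s 19" and tv = "\<lambda>_ _ _. 0" and fv = "\<lambda>_ _. 1" and B = B])
    subgoal using s by (simp add: agree_def)
    subgoal using s by (simp add: agree_def)
    subgoal by (rule B)
    subgoal by (rule B)
    subgoal by simp
    subgoal using dU dW dQ2 by simp
    subgoal using dU dW dQ2 by simp
    subgoal using s dU dW dQ2 by (simp add: stores_def  del: index_mult_mat(1))
    subgoal by simp
    subgoal using dU dW dQ2 by (auto simp: stores_def output_matrix_def block_def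
        intro!: eq_matI simp del: index_mult_mat(1) index_add_mat(1))
    done
  let ?min = "\<lambda>s. is_arg_min (\<lambda>V. (frobenius_norm (U + outer_sum n k a b - V))\<^sup>2)
      (\<lambda>V. V \<in> unitary_matrices n) (output_matrix n s)"
  let ?J = "\<lambda>(j :: nat) s. if j = 0 then s = input_state n k U a b else ?min s"
  let ?T = "1 + (2 * B + (10 * B + (8 * B + (21 * B + (16 * B + (21 * B + (36 * B + (11 * B +
    (9 * B + (9 * B + (10 * B + 8 * B)))))))))))"
  have "runs closest_unitary (input_state n k U a b) (1 * (?T + 1)) (?J 1)"
    unfolding closest_unitary_def
  proof (rule runs_For[where I = ?J], goal_cases)
    \<comment> \<open>Truncated subtraction makes the loop bound \<open>1 - (1 - k)\<close> equal to
      1 for positive \<open>k\<close>.\<close>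
    case 1
    show ?case
      using k by (simp add: input_state_def)
  next
    case 2
    show ?case
      by simp
  next
    case (3 j s)
    then have *: "j = 0" "s = input_state n k U a b" "?J (Suc j) = ?min"
      by auto
    show ?case
      unfolding *
    proof (rule runs_Seq, rule phase0, rule runs_Seq, rule phase1, assumption,
        rule runs_Seq, rule phase2, assumption, rule runs_Seq, rule phase3, assumption, rule runs_Seq, rule phase4, assumption,
        rule runs_Seq, rule phase5, assumption, rule runs_Seq, rule phase6, assumption,
        rule runs_Seq, rule phase7, assumption, goal_cases)
      case (1 _ _ _ _ _ _ _ s8)
      then obtain F where F: "?F F" "?I8 F s8"
        by blast
      note min = closest[OF conjunct1[OF F(1)] conjunct2[OF F(1)]]
      show ?case
        by (rule runs_Seq, rule phase8[OF F], rule runs_Seq, rule phase9, assumption,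
            rule runs_Seq, rule phase10, assumption, rule F(1), rule runs_Seq, rule phase11, assumption,
            rule runs_mono, rule phase12, assumption, simp, simp add: min)
    qed
  qed
  then show ?thesis
  proof (rule runs_mono)
    \<comment> \<open>The phases add up to 161 \<open>B\<close>. The first assignment and the single
      outer iteration add 2, at most 2 \<open>B\<close>, and 163 * 8 = 1304.\<close>
    show "1 * (?T + 1) \<le> 1304 * (k * (n\<^sup>2 + n * k + k\<^sup>2))"
      using B(1) by (simp add: B_def)
  qed auto
qed

end

lemma closest_unitary_correct:
  fixes U :: "'a :: {conjugatable_field, real_normed_field} mat"
  assumes "scalars rt" "eigendecomposer eig" and U: "U \<in> unitary_matrices n"
  shows "\<exists>s t. run rt eig closest_unitary (input_state n k U a b) = (s, t) \<and>
    is_arg_min (\<lambda>V. (frobenius_norm (U + outer_sum n k a b - V))\<^sup>2)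
      (\<lambda>V. V \<in> unitary_matrices n) (output_matrix n s) \<and>
    real t \<le> 1304 * real (k * (n\<^sup>2 + n * k + k\<^sup>2))"
proof -
  interpret machine rt eig
    using assms by (simp add: machine_def machine_axioms_def)
  show ?thesis
  proof (cases "k = 0")
    case True
    note dU = unitary_matricesD[OF U]
    let ?s = "input_state n k U a b"
    have "run rt eig closest_unitary ?s = (?s, 0)"
      using True by (simp add: closest_unitary_def input_state_def)
    moreover have "output_matrix n ?s = U" "U + outer_sum n k a b = U"
      using dU True
      by (auto simp: output_matrix_def block_def input_state_def outer_sum_def intro!: eq_matI)
    \<comment> \<open>\<open>U\<close> is its own unitary polar factor, with positive part
      1.\<close>
    moreover have "is_arg_min (\<lambda>V. (frobenius_norm (U - V))\<^sup>2) (\<lambda>V. V \<in> unitary_matrices n) U"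
      using dU by (intro polar_factor_is_arg_min[OF U, where R = "1\<^sub>m n"]) auto
    ultimately show ?thesis
      by (simp del: of_nat_mult of_nat_add)
  next
    case False
    obtain s t where "run rt eig closest_unitary (input_state n k U a b) = (s, t)"
      by fastforce
    moreover from this runs_closest_unitary[OF U, of k a b] False
    have "t \<le> 1304 * (k * (n\<^sup>2 + n * k + k\<^sup>2))"
      and "is_arg_min (\<lambda>V. (frobenius_norm (U + outer_sum n k a b - V))\<^sup>2)
        (\<lambda>V. V \<in> unitary_matrices n) (output_matrix n s)"
      by (simp_all add: runs_def)
    moreover from this(1) have "real t \<le> real (1304 * (k * (n\<^sup>2 + n * k + k\<^sup>2)))"
      by (simp only: of_nat_le_iff)
    ultimately show ?thesis
      by (auto simp only: of_nat_mult of_nat_numeral)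
  qed
qed

section \<open>The complex and the real scalars\<close>

lemma scalars_csqrt: "scalars csqrt"
proof
  fix x :: complex and r :: real
  show "x * conjugate x = of_real ((norm x)\<^sup>2)"
    using complex_norm_square[of x] by simp
  show "csqrt (of_real r) = of_real (sqrt r)" if "r \<ge> 0"
    using that by simp
qed simp

lemma scalars_sqrt: "scalars sqrt"
  by standard (simp_all add: power2_eq_square)

text \<open>One program text and one constant serve both fields; only the interpretation of square
  roots, conjugation and eigendecompositions changes.\<close>

theorem theorem4p2:
  shows
   "(\<exists>(P :: com) (C :: real).
       \<forall>(eig :: complex mat \<Rightarrow> complex mat \<times> complex vec) (n :: nat) (k :: nat)
         (U :: complex mat) (G :: complex mat)
         (a :: nat \<Rightarrow> complex vec) (b :: nat \<Rightarrow> complex vec).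
         eigendecomposer eig \<longrightarrow>
         U \<in> unitary_matrices n \<longrightarrow>
         G \<in> carrier_mat n n \<longrightarrow>
         vec_space.rank n G = k \<longrightarrow>
         (\<forall>i<k. a i \<in> carrier_vec n \<and> b i \<in> carrier_vec n) \<longrightarrow>
         G = outer_sum n k a b \<longrightarrow>
         (\<exists>s t. run csqrt eig P (input_state n k U a b) = (s, t) \<and>
            is_arg_min (\<lambda>V. (frobenius_norm (U + G - V))\<^sup>2) (\<lambda>V. V \<in> unitary_matrices n)
              (output_matrix n s) \<and>
            real t \<le> C * real (k * (n\<^sup>2 + n * k + k\<^sup>2))))
    \<and>
    (\<exists>(P :: com) (C :: real).
       \<forall>(eig :: real mat \<Rightarrow> real mat \<times> real vec) (n :: nat) (k :: nat)
         (U :: real mat) (G :: real mat)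
         (a :: nat \<Rightarrow> real vec) (b :: nat \<Rightarrow> real vec).
         eigendecomposer eig \<longrightarrow>
         U \<in> unitary_matrices n \<longrightarrow>
         G \<in> carrier_mat n n \<longrightarrow>
         vec_space.rank n G = k \<longrightarrow>
         (\<forall>i<k. a i \<in> carrier_vec n \<and> b i \<in> carrier_vec n) \<longrightarrow>
         G = outer_sum n k a b \<longrightarrow>
         (\<exists>s t. run sqrt eig P (input_state n k U a b) = (s, t) \<and>
            is_arg_min (\<lambda>V. (frobenius_norm (U + G - V))\<^sup>2) (\<lambda>V. V \<in> unitary_matrices n)
              (output_matrix n s) \<and>
            real t \<le> C * real (k * (n\<^sup>2 + n * k + k\<^sup>2))))"
proof (intro conjI exI[of _ closest_unitary] exI[of _ 1304] allI impI)
  fix eig :: "complex mat \<Rightarrow> complex mat \<times> complex vec" and n k :: nat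
    and U G :: "complex mat" and a b :: "nat \<Rightarrow> complex vec"
  assume "eigendecomposer eig" "U \<in> unitary_matrices n" "G = outer_sum n k a b"
  then show "\<exists>s t. run csqrt eig closest_unitary (input_state n k U a b) = (s, t) \<and>
      is_arg_min (\<lambda>V. (frobenius_norm (U + G - V))\<^sup>2) (\<lambda>V. V \<in> unitary_matrices n)
        (output_matrix n s) \<and>
      real t \<le> 1304 * real (k * (n\<^sup>2 + n * k + k\<^sup>2))"
    using closest_unitary_correct[OF scalars_csqrt] by blast
next
  fix eig :: "real mat \<Rightarrow> real mat \<times> real vec" and n k :: nat
    and U G :: "real mat" and a b :: "nat \<Rightarrow> real vec"
  assume "eigendecomposer eig" "U \<in> unitary_matrices n" "G = outer_sum n k a b"
  then show "\<exists>s t. run sqrt eig closest_unitary (input_state n k U a b) = (s, t) \<and>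
      is_arg_min (\<lambda>V. (frobenius_norm (U + G - V))\<^sup>2) (\<lambda>V. V \<in> unitary_matrices n)
        (output_matrix n s) \<and>
      real t \<le> 1304 * real (k * (n\<^sup>2 + n * k + k\<^sup>2))"
    using closest_unitary_correct[OF scalars_sqrt] by blast
qed

end
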